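(* Let $R$ be an indecomposable, non-local ring. The following conditions are equivalent: (1) $R$ is a right $q$-ring; (2) $R$ is a right CS ring and a right $a$-ring.
   Context: Rings are associative with identity; modules are right unital. A ring is indecomposable if it is not a direct product of two nonzero rings. A right module $M$ is quasi-injective if $f(M)\subseteq M$ for every endomorphism $f$ of its injective envelope $E(M)$, and automorphism-invariant if $\varphi(M)\subseteq M$ for every automorphism $\varphi$ of $E(M)$. A ring is a right $q$-ring if every right ideal is quasi-injective as a right module, and a right $a$-ring if every right ideal is automorphism-invariant as a right module. A module $M$ is CS if every submodule of $M$ is essential in a direct summand of $M$; a ring $R$ is right CS if $R_R$ is a CS module. *)

theory Defs
  imports "HOL-Algebra.Algebra" Complex_Main
begin

section \<open>Right modules over a ring\<close>

text \<open>
  The module locale of HOL-Algebra is restricted to commutative rings, so unital right modules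
  over arbitrary rings are introduced here.  As for the library's module record, only the additive
  part of the underlying ring record is used; its fields mult and one are junk.
\<close>

record ('a, 'b) right_module = "'b ring" +
  ract :: "['b, 'a] \<Rightarrow> 'b" (infixl \<open>\<star>\<index>\<close> 70)

locale right_module = R?: ring R + M?: abelian_group M
  for R :: "('a, 'r) ring_scheme" (structure) and M :: "('a, 'b, 'm) right_module_scheme" (structure) +
  assumes ract_closed [simp, intro]:
      "\<lbrakk>x \<in> carrier M; a \<in> carrier R\<rbrakk> \<Longrightarrow> x \<star>\<^bsub>M\<^esub> a \<in> carrier M"
    and ract_add_scalar:
      "\<lbrakk>x \<in> carrier M; a \<in> carrier R; b \<in> carrier R\<rbrakk>
        \<Longrightarrow> x \<star>\<^bsub>M\<^esub> (a \<oplus> b) = x \<star>\<^bsub>M\<^esub> a \<oplus>\<^bsub>M\<^esub> x \<star>\<^bsub>M\<^esub> b"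
    and ract_add:
      "\<lbrakk>x \<in> carrier M; y \<in> carrier M; a \<in> carrier R\<rbrakk>
        \<Longrightarrow> (x \<oplus>\<^bsub>M\<^esub> y) \<star>\<^bsub>M\<^esub> a = x \<star>\<^bsub>M\<^esub> a \<oplus>\<^bsub>M\<^esub> y \<star>\<^bsub>M\<^esub> a"
    and ract_mult:
      "\<lbrakk>x \<in> carrier M; a \<in> carrier R; b \<in> carrier R\<rbrakk>
        \<Longrightarrow> x \<star>\<^bsub>M\<^esub> (a \<otimes> b) = x \<star>\<^bsub>M\<^esub> a \<star>\<^bsub>M\<^esub> b"
    and ract_one [simp]:
      "x \<in> carrier M \<Longrightarrow> x \<star>\<^bsub>M\<^esub> \<one> = x"

definition rsubmodule ::
  "('a, 'r) ring_scheme \<Rightarrow> 'b set \<Rightarrow> ('a, 'b, 'm) right_module_scheme \<Rightarrow> bool" where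
  "rsubmodule R N M \<longleftrightarrow>
     additive_subgroup N M \<and> (\<forall>x\<in>N. \<forall>a\<in>carrier R. x \<star>\<^bsub>M\<^esub> a \<in> N)"

definition rmod_hom ::
  "('a, 'r) ring_scheme \<Rightarrow> ('a, 'b, 'm) right_module_scheme \<Rightarrow> ('a, 'c, 'n) right_module_scheme
    \<Rightarrow> ('b \<Rightarrow> 'c) set" where
  "rmod_hom R M N =
     {f \<in> carrier M \<rightarrow> carrier N.
        (\<forall>x\<in>carrier M. \<forall>y\<in>carrier M. f (x \<oplus>\<^bsub>M\<^esub> y) = f x \<oplus>\<^bsub>N\<^esub> f y) \<and>
        (\<forall>x\<in>carrier M. \<forall>a\<in>carrier R. f (x \<star>\<^bsub>M\<^esub> a) = f x \<star>\<^bsub>N\<^esub> a)}"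

definition rmod_aut ::
  "('a, 'r) ring_scheme \<Rightarrow> ('a, 'b, 'm) right_module_scheme \<Rightarrow> ('b \<Rightarrow> 'b) set" where
  "rmod_aut R M = {f \<in> rmod_hom R M M. bij_betw f (carrier M) (carrier M)}"

definition essential_submodule ::
  "('a, 'r) ring_scheme \<Rightarrow> 'b set \<Rightarrow> ('a, 'b, 'm) right_module_scheme \<Rightarrow> bool" where
  "essential_submodule R N M \<longleftrightarrow>
     rsubmodule R N M \<and>
     (\<forall>K. rsubmodule R K M \<and> N \<inter> K = {\<zero>\<^bsub>M\<^esub>} \<longrightarrow> K = {\<zero>\<^bsub>M\<^esub>})"

definition direct_summand ::
  "('a, 'r) ring_scheme \<Rightarrow> 'b set \<Rightarrow> ('a, 'b, 'm) right_module_scheme \<Rightarrow> bool" where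
  "direct_summand R D M \<longleftrightarrow>
     rsubmodule R D M \<and>
     (\<exists>C. rsubmodule R C M \<and> D \<inter> C = {\<zero>\<^bsub>M\<^esub>} \<and> D <+>\<^bsub>M\<^esub> C = carrier M)"

definition CS_module ::
  "('a, 'r) ring_scheme \<Rightarrow> ('a, 'b, 'm) right_module_scheme \<Rightarrow> bool" where
  "CS_module R M \<longleftrightarrow>
     (\<forall>N. rsubmodule R N M \<longrightarrow>
        (\<exists>D. direct_summand R D M \<and> essential_submodule R N (M\<lparr>carrier := D\<rparr>)))"


section \<open>Injective envelopes\<close>

text \<open>
  HOL cannot quantify over types inside a formula, so the extension property is required for
  monomorphisms \<open>g : A \<rightarrow> B\<close> of modules carried by the type of \<open>E\<close> itself.  Whenever the
  type \<open>'a\<close> of the ring embeds into \<open>'e\<close> this is injectivity in the category of all right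
  modules: the inclusions of right ideals into \<open>R\<close> are then among the test maps, up to
  isomorphism, and Baer's criterion applies.
\<close>

definition injective_rmod ::
  "('a, 'r) ring_scheme \<Rightarrow> ('a, 'e) right_module \<Rightarrow> bool" where
  "injective_rmod R E \<longleftrightarrow>
     (\<forall>(A :: ('a, 'e) right_module) (B :: ('a, 'e) right_module) g f.
        right_module R A \<and> right_module R B \<and>
        g \<in> rmod_hom R A B \<and> inj_on g (carrier A) \<and> f \<in> rmod_hom R A E \<longrightarrow>
        (\<exists>h\<in>rmod_hom R B E. \<forall>x\<in>carrier A. h (g x) = f x))"

text \<open>
  An injective envelope of \<open>M\<close> is an injective module \<open>E\<close> with an embedding \<open>\<iota>\<close> of \<open>M\<close> onto
  an essential submodule of \<open>E\<close>.
\<close>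

definition injective_envelope ::
  "('a, 'r) ring_scheme \<Rightarrow> ('a, 'b, 'm) right_module_scheme
    \<Rightarrow> ('a, 'e) right_module \<Rightarrow> ('b \<Rightarrow> 'e) \<Rightarrow> bool" where
  "injective_envelope R M E \<iota> \<longleftrightarrow>
     right_module R E \<and> injective_rmod R E \<and>
     \<iota> \<in> rmod_hom R M E \<and> inj_on \<iota> (carrier M) \<and>
     essential_submodule R (\<iota> ` carrier M) E"

text \<open>
  A type large enough to carry an injective envelope of any right \<open>R\<close>-module \<open>M\<close> with
  \<open>R\<close> over \<open>'a\<close> and \<open>M\<close> over \<open>'b\<close>: writing \<open>M\<^sup>+ = Hom(M, \<rat>/\<int>)\<close> (additive maps), the
  module \<open>M\<close> embeds into the product of \<open>M\<^sup>+\<close> many copies of the injective right module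
  \<open>Hom(R, \<rat>/\<int>)\<close>, and a maximal essential extension of \<open>M\<close> inside this product is an
  injective envelope.  Representing \<open>\<rat>/\<int>\<close> by the rationals in \<open>[0,1)\<close>, the elements of the
  product become functions of the type below, into which \<open>'a\<close> embeds as well.
\<close>

type_synonym ('a, 'b) envelope = "('b \<Rightarrow> rat) \<Rightarrow> 'a \<Rightarrow> rat"

text \<open>
  Injective envelopes are unique up to an isomorphism over \<open>M\<close>, so it does not matter which one
  is used in the next two definitions; \<open>M\<close> is identified with its image \<open>\<iota> ` carrier M\<close>.
\<close>

definition quasi_injective ::
  "('a, 'r) ring_scheme \<Rightarrow> ('a, 'b, 'm) right_module_scheme \<Rightarrow> bool" where
  "quasi_injective R M \<longleftrightarrow>
     (\<exists>(E :: ('a, ('a, 'b) envelope) right_module) \<iota>.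
        injective_envelope R M E \<iota> \<and>
        (\<forall>f\<in>rmod_hom R E E. f ` (\<iota> ` carrier M) \<subseteq> \<iota> ` carrier M))"

definition automorphism_invariant ::
  "('a, 'r) ring_scheme \<Rightarrow> ('a, 'b, 'm) right_module_scheme \<Rightarrow> bool" where
  "automorphism_invariant R M \<longleftrightarrow>
     (\<exists>(E :: ('a, ('a, 'b) envelope) right_module) \<iota>.
        injective_envelope R M E \<iota> \<and>
        (\<forall>\<phi>\<in>rmod_aut R E. \<phi> ` (\<iota> ` carrier M) \<subseteq> \<iota> ` carrier M))"


section \<open>Conditions on rings\<close>

definition regular_rmod :: "('a, 'r) ring_scheme \<Rightarrow> ('a, 'a) right_module" where
  "regular_rmod R =
     \<lparr>carrier = carrier R, monoid.mult = monoid.mult R, one = one R, ring.zero = ring.zero R, ring.add = ring.add R,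
      ract = monoid.mult R\<rparr>"

definition right_ideal :: "'a set \<Rightarrow> ('a, 'r) ring_scheme \<Rightarrow> bool" where
  "right_ideal I R \<longleftrightarrow> rsubmodule R I (regular_rmod R)"

abbreviation right_ideal_rmod :: "('a, 'r) ring_scheme \<Rightarrow> 'a set \<Rightarrow> ('a, 'a) right_module" where
  "right_ideal_rmod R I \<equiv> (regular_rmod R)\<lparr>carrier := I\<rparr>"

definition right_q_ring :: "('a, 'r) ring_scheme \<Rightarrow> bool" where
  "right_q_ring R \<longleftrightarrow> (\<forall>I. right_ideal I R \<longrightarrow> quasi_injective R (right_ideal_rmod R I))"

definition right_a_ring :: "('a, 'r) ring_scheme \<Rightarrow> bool" where
  "right_a_ring R \<longleftrightarrow> (\<forall>I. right_ideal I R \<longrightarrow> automorphism_invariant R (right_ideal_rmod R I))"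

definition right_CS_ring :: "('a, 'r) ring_scheme \<Rightarrow> bool" where
  "right_CS_ring R \<longleftrightarrow> CS_module R (regular_rmod R)"

text \<open>
  The factors of a decomposition of \<open>R\<close> are in bijection with subsets of \<open>carrier R\<close>, so
  factors over the type \<open>'a\<close> suffice.
\<close>

definition indecomposable_ring :: "('a, 'r) ring_scheme \<Rightarrow> bool" where
  "indecomposable_ring R \<longleftrightarrow>
     \<not> (\<exists>(S :: 'a ring) (T :: 'a ring).
          ring S \<and> ring T \<and> carrier S \<noteq> {\<zero>\<^bsub>S\<^esub>} \<and> carrier T \<noteq> {\<zero>\<^bsub>T\<^esub>} \<and>
          R \<simeq> RDirProd S T)"

definition maximal_right_ideal :: "'a set \<Rightarrow> ('a, 'r) ring_scheme \<Rightarrow> bool" where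
  "maximal_right_ideal I R \<longleftrightarrow>
     right_ideal I R \<and> I \<noteq> carrier R \<and>
     (\<forall>J. right_ideal J R \<and> I \<subseteq> J \<longrightarrow> J = I \<or> J = carrier R)"

definition local_ring :: "('a, 'r) ring_scheme \<Rightarrow> bool" where
  "local_ring R \<longleftrightarrow> (\<exists>!I. maximal_right_ideal I R)"


section \<open>The regular module and right ideals are right modules\<close>

lemma right_module_regular:
  assumes "ring R"
  shows "right_module R (regular_rmod R)"
proof -
  interpret ring R by fact
  have "abelian_group (regular_rmod R)"
    by (rule abelian_groupI)
      (auto simp: regular_rmod_def a_ac intro!: bexI[of _ "\<ominus>\<^bsub>R\<^esub> _"] r_neg)
  then show ?thesis
    by (intro right_module.intro right_module_axioms.intro assms)
      (auto simp: regular_rmod_def l_distr r_distr m_assoc)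
qed

lemma right_module_rsubmodule:
  assumes "right_module R M" "rsubmodule R N M"
  shows "right_module R (M\<lparr>carrier := N\<rparr>)"
proof -
  interpret right_module R M by fact
  interpret N: additive_subgroup N M using assms(2) by (simp add: rsubmodule_def)
  have sub: "x \<in> carrier M" if "x \<in> N" for x using that N.a_subset by blast
  have "abelian_group (M\<lparr>carrier := N\<rparr>)"
    by (rule abelian_groupI)
      (auto simp: M.a_ac sub intro!: bexI[of _ "\<ominus>\<^bsub>M\<^esub> _"] M.r_neg N.a_inv_closed)
  then show ?thesis
    using assms(2)
    by (intro right_module.intro right_module_axioms.intro R.ring_axioms)
      (auto simp: rsubmodule_def ract_add_scalar ract_add ract_mult sub)
qed

end

theory Submission
  imports Defs
begin

text \<open>
  Let \<open>E\<close> be an injective envelope of \<open>R\<close>, so that right ideals become submodules of \<open>E\<close>.  An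
  idempotent endomorphism of \<open>E\<close> is a direct decomposition \<open>E = pE \<oplus> qE\<close>, and an off-diagonal map
  \<open>p f q\<close> has square zero, so that \<open>1 + p f q\<close> is an automorphism.  Hence every
  automorphism-invariant submodule is invariant under all off-diagonal maps, and this drives
  both halves of the proof that a right CS right a-ring is a right q-ring.

  The first half concerns an automorphism-invariant submodule \<open>M\<close> of an arbitrary injective
  module.  If \<open>M\<close> is CS, then it is invariant under all idempotents
  (\<open>CS_splitting_invariant\<close>).  If \<open>M\<close> is invariant under all automorphisms and all idempotents, then
  it is invariant under every endomorphism (\<open>endo_invariant\<close>).  For the latter take, by Zorn, a
  maximal isomorphism \<open>k : X \<rightarrow> Y\<close> between independent submodules, and decompose
  \<open>E = E(X) \<oplus> E(Y) \<oplus> C\<close>.  The diagonal blocks of an endomorphism on \<open>E(X)\<close> and \<open>E(Y)\<close> factor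
  through the other summand, up to a map with essential kernel, so they are products of
  off-diagonal maps.  By maximality \<open>C\<close> contains no two independent isomorphic nonzero
  submodules, and over such a \<open>C\<close> a block splits into a part with essential kernel and an
  automorphism.  A map \<open>j\<close> with essential kernel is harmless because \<open>1 + j\<close> is an automorphism.

  The second half passes from \<open>R\<close> to its right ideals.  Let every essential right ideal of \<open>R\<close> be
  automorphism-invariant, and let \<open>R\<close> itself be invariant under idempotents.  For an essential
  right ideal \<open>N\<close>, the right ideal \<open>(N \<inter> pE) + qR\<close> is again essential.  Its invariance under
  \<open>p f q\<close> shows that \<open>p f q\<close> maps all of \<open>R\<close> into \<open>N\<close>.  So modulo \<open>N\<close> idempotents commute
  with endomorphisms, and this makes \<open>N\<close> invariant under idempotents
  (\<open>essential_splitting_invariant\<close>), hence under all endomorphisms.  An arbitrary right ideal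
  \<open>I\<close> has an envelope of the form \<open>pE\<close>, and \<open>I + (R \<inter> qE)\<close> is essential; its invariance gives
  that of \<open>I\<close>.

  Conversely, if \<open>R\<close> is invariant under all endomorphisms of \<open>E\<close>, then the decomposition
  \<open>E = pE \<oplus> qE\<close> with \<open>pE\<close> an envelope of a right ideal \<open>N\<close> restricts to a decomposition of \<open>R\<close>
  whose first summand contains \<open>N\<close> as an essential submodule.
\<close>

section \<open>Submodules and endomorphisms\<close>

context right_module
begin

lemma ract_zero_scalar:
  assumes "x \<in> carrier M"
  shows "x \<star>\<^bsub>M\<^esub> \<zero> = \<zero>\<^bsub>M\<^esub>"
proof -
  have "x \<star>\<^bsub>M\<^esub> \<zero> \<oplus>\<^bsub>M\<^esub> x \<star>\<^bsub>M\<^esub> \<zero> = x \<star>\<^bsub>M\<^esub> \<zero>"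
    using assms ract_add_scalar[of x "\<zero>" "\<zero>"] by simp
  then show ?thesis using assms by (simp add: M.add.l_cancel_one)
qed

lemma ract_minus_one:
  assumes "x \<in> carrier M"
  shows "x \<star>\<^bsub>M\<^esub> (\<ominus> \<one>) = \<ominus>\<^bsub>M\<^esub> x"
proof -
  have "x \<star>\<^bsub>M\<^esub> (\<ominus> \<one>) \<oplus>\<^bsub>M\<^esub> x = x \<star>\<^bsub>M\<^esub> (\<ominus> \<one> \<oplus> \<one>)"
    using assms by (simp add: ract_add_scalar)
  also have "\<dots> = \<zero>\<^bsub>M\<^esub>" using assms by (simp add: ract_zero_scalar R.l_neg)
  finally show ?thesis using assms by (simp add: M.minus_equality)
qed

lemma rsubmodule_iff:
  "rsubmodule R N M \<longleftrightarrow>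
     N \<subseteq> carrier M \<and> \<zero>\<^bsub>M\<^esub> \<in> N \<and> (\<forall>x\<in>N. \<forall>y\<in>N. x \<oplus>\<^bsub>M\<^esub> y \<in> N) \<and>
     (\<forall>x\<in>N. \<forall>a\<in>carrier R. x \<star>\<^bsub>M\<^esub> a \<in> N)" (is "?l \<longleftrightarrow> ?r")
proof
  assume ?l
  then interpret N: additive_subgroup N M by (simp add: rsubmodule_def)
  show ?r using \<open>?l\<close> N.a_subset N.zero_closed N.a_closed by (auto simp: rsubmodule_def)
next
  assume r: ?r
  have "\<ominus>\<^bsub>M\<^esub> x \<in> N" if "x \<in> N" for x
  proof -
    have "x \<star>\<^bsub>M\<^esub> (\<ominus> \<one>) \<in> N" using r that by simp
    moreover have "x \<in> carrier M" using r that by blast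
    ultimately show ?thesis by (simp add: ract_minus_one)
  qed
  then have "subgroup N (add_monoid M)"
    using r by (intro M.add.subgroupI) (auto simp: a_inv_def)
  then show ?l using r by (auto simp: rsubmodule_def additive_subgroup_def)
qed

lemma rsubmodule_restrict_iff:
  assumes "rsubmodule R D M"
  shows "rsubmodule R N (M\<lparr>carrier := D\<rparr>) \<longleftrightarrow> rsubmodule R N M \<and> N \<subseteq> D"
proof -
  have "D \<subseteq> carrier M" using assms by (simp add: rsubmodule_iff)
  then show ?thesis
    unfolding right_module.rsubmodule_iff[OF right_module_rsubmodule[OF right_module_axioms assms]]
      rsubmodule_iff[of N]
    by (simp, blast)
qed

end

locale injective_module = right_module R E
  for R :: "('a, 'r) ring_scheme" and E :: "('a, 'e) right_module" (structure) +
  assumes injective: "injective_rmod R E"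
begin

abbreviation submod :: "'e set \<Rightarrow> bool" where
  "submod N \<equiv> rsubmodule R N E"

abbreviation endo :: "('e \<Rightarrow> 'e) \<Rightarrow> bool" where
  "endo f \<equiv> f \<in> rmod_hom R E E"

lemma submodI:
  assumes "N \<subseteq> carrier E" "\<zero> \<in> N" "\<And>x y. x \<in> N \<Longrightarrow> y \<in> N \<Longrightarrow> x \<oplus> y \<in> N"
    "\<And>x a. x \<in> N \<Longrightarrow> a \<in> carrier R \<Longrightarrow> x \<star> a \<in> N"
  shows "submod N"
  using assms by (auto simp: rsubmodule_iff)

lemma submodD:
  assumes "submod N"
  shows "N \<subseteq> carrier E" "\<zero> \<in> N" "x \<in> N \<Longrightarrow> x \<in> carrier E"
    "x \<in> N \<Longrightarrow> y \<in> N \<Longrightarrow> x \<oplus> y \<in> N"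
    "x \<in> N \<Longrightarrow> a \<in> carrier R \<Longrightarrow> x \<star> a \<in> N"
  using assms by (auto simp: rsubmodule_iff)

lemma submod_minus: "submod N \<Longrightarrow> x \<in> N \<Longrightarrow> \<ominus> x \<in> N"
  using submodD(3)[of N x] submodD(5)[of N x "\<ominus>\<^bsub>R\<^esub> \<one>\<^bsub>R\<^esub>"] ract_minus_one[of x] by simp

lemma submod_diff: "submod N \<Longrightarrow> x \<in> N \<Longrightarrow> y \<in> N \<Longrightarrow> x \<ominus> y \<in> N"
  by (simp add: a_minus_def submodD submod_minus)

lemma submod_cancel:
  assumes "submod N" "x \<in> N" "x \<oplus> y \<in> N" "y \<in> carrier E"
  shows "y \<in> N"
proof -
  have "\<ominus> x \<oplus> (x \<oplus> y) = y" using assms submodD(3) by (simp add: M.r_neg1)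
  then show ?thesis using assms submod_minus submodD(4) by metis
qed

lemma diff_zero_eq:
  assumes "x \<ominus> y = \<zero>" "x \<in> carrier E" "y \<in> carrier E"
  shows "x = y"
  using assms M.minus_equality[of x "\<ominus> y"] by (simp add: a_minus_def)

lemma zero_ract: "a \<in> carrier R \<Longrightarrow> \<zero> \<star> a = \<zero>"
  using ract_add[of "\<zero>" "\<zero>" a] by (simp add: M.add.l_cancel_one)

lemma submod_carrier: "submod (carrier E)"
  by (rule submodI) auto

lemma submod_Int: "submod N \<Longrightarrow> submod K \<Longrightarrow> submod (N \<inter> K)"
  by (auto simp: rsubmodule_iff)

lemma endoI:
  assumes "\<And>x. x \<in> carrier E \<Longrightarrow> f x \<in> carrier E"
    "\<And>x y. x \<in> carrier E \<Longrightarrow> y \<in> carrier E \<Longrightarrow> f (x \<oplus> y) = f x \<oplus> f y"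
    "\<And>x a. x \<in> carrier E \<Longrightarrow> a \<in> carrier R \<Longrightarrow> f (x \<star> a) = f x \<star> a"
  shows "endo f"
  using assms by (auto simp: rmod_hom_def)

lemma endoD:
  assumes "endo f"
  shows "x \<in> carrier E \<Longrightarrow> f x \<in> carrier E"
    "x \<in> carrier E \<Longrightarrow> y \<in> carrier E \<Longrightarrow> f (x \<oplus> y) = f x \<oplus> f y"
    "x \<in> carrier E \<Longrightarrow> a \<in> carrier R \<Longrightarrow> f (x \<star> a) = f x \<star> a"
  using assms by (auto simp: rmod_hom_def)

lemma endo_zero: "endo f \<Longrightarrow> f \<zero> = \<zero>"
  using endoD(1)[of f "\<zero>"] endoD(2)[of f "\<zero>" "\<zero>"] by (simp add: M.add.l_cancel_one)

lemma endo_minus: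
  assumes "endo f" "x \<in> carrier E"
  shows "f (\<ominus> x) = \<ominus> f x"
  using assms endoD(3)[of f x "\<ominus>\<^bsub>R\<^esub> \<one>\<^bsub>R\<^esub>"] endoD(1) by (simp add: ract_minus_one)

lemma endo_diff:
  assumes "endo f" "x \<in> carrier E" "y \<in> carrier E"
  shows "f (x \<ominus> y) = f x \<ominus> f y"
  using assms by (simp add: a_minus_def endoD endo_minus)

lemma endo_comp: "endo f \<Longrightarrow> endo g \<Longrightarrow> endo (\<lambda>x. f (g x))"
  by (auto intro!: endoI simp: endoD)

lemma endo_add: "endo f \<Longrightarrow> endo g \<Longrightarrow> endo (\<lambda>x. f x \<oplus> g x)"
  by (auto intro!: endoI simp: endoD ract_add M.a_ac)

lemma minus_ract:
  assumes "x \<in> carrier E" "a \<in> carrier R"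
  shows "(\<ominus> x) \<star> a = \<ominus> (x \<star> a)"
proof -
  have "(\<ominus> x) \<star> a \<oplus> x \<star> a = (\<ominus> x \<oplus> x) \<star> a"
    by (rule ract_add[symmetric]) (use assms in auto)
  also have "\<dots> = \<zero>" using assms by (simp add: M.l_neg zero_ract)
  finally show ?thesis using assms M.minus_equality by (metis M.a_inv_closed ract_closed)
qed

lemma endo_uminus: "endo f \<Longrightarrow> endo (\<lambda>x. \<ominus> f x)"
  by (auto intro!: endoI simp: endoD minus_ract M.minus_add)

lemma endo_subtract: "endo f \<Longrightarrow> endo g \<Longrightarrow> endo (\<lambda>x. f x \<ominus> g x)"
  unfolding a_minus_def by (intro endo_add endo_uminus)

lemma endo_id: "endo (\<lambda>x. x)"
  by (auto intro!: endoI)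

lemma endo_const_zero: "endo (\<lambda>x. \<zero>)"
  by (auto intro!: endoI simp: zero_ract)

lemma submod_image:
  assumes "endo f" "submod N"
  shows "submod (f ` N)"
proof (rule submodI)
  show "\<zero> \<in> f ` N" using assms endo_zero submodD(2) by (metis imageI)
  show "x \<oplus> y \<in> f ` N" if "x \<in> f ` N" "y \<in> f ` N" for x y
  proof -
    from that obtain s t where "s \<in> N" "t \<in> N" "x = f s" "y = f t" by blast
    then show ?thesis
      using submodD(3,4)[OF assms(2)] endoD(2)[OF assms(1)] by (auto intro!: image_eqI[of _ _ "s \<oplus> t"])
  qed
  show "x \<star> a \<in> f ` N" if "x \<in> f ` N" "a \<in> carrier R" for x a
  proof -
    from that obtain s where "s \<in> N" "x = f s" by blast
    then show ?thesis using that(2)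
      using submodD(3,5)[OF assms(2)] endoD(3)[OF assms(1)] by (auto intro!: image_eqI[of _ _ "s \<star> a"])
  qed
qed (use submodD(3)[OF assms(2)] endoD(1)[OF assms(1)] in auto)

lemma submod_vimage:
  assumes "endo f" "submod N"
  shows "submod {x \<in> carrier E. f x \<in> N}"
  using assms by (intro submodI) (auto simp: endo_zero submodD endoD)

lemma submod_zero: "submod {\<zero>}"
  by (rule submodI) (auto simp: zero_ract)

lemma submod_ker: "endo f \<Longrightarrow> submod {x \<in> carrier E. f x = \<zero>}"
  using submod_vimage[OF _ submod_zero] by auto

lemma submod_set_sum:
  assumes "submod N" "submod K"
  shows "submod {x \<oplus> y | x y. x \<in> N \<and> y \<in> K}"
proof (rule submodI)
  let ?S = "{x \<oplus> y | x y. x \<in> N \<and> y \<in> K}"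
  show "?S \<subseteq> carrier E" using submodD assms by auto
  show "\<zero> \<in> ?S" using submodD(2)[OF assms(1)] submodD(2)[OF assms(2)]
    by (auto intro!: exI[of _ "\<zero>"])
  show "s \<oplus> t \<in> ?S" if st: "s \<in> ?S" "t \<in> ?S" for s t
  proof -
    from st obtain x y x' y' where *: "s = x \<oplus> y" "x \<in> N" "y \<in> K"
      "t = x' \<oplus> y'" "x' \<in> N" "y' \<in> K" by blast
    then have "s \<oplus> t = (x \<oplus> x') \<oplus> (y \<oplus> y')"
      using assms submodD(3) by (simp add: M.a_ac)
    then show ?thesis using * assms submodD(4) by blast
  qed
  show "s \<star> a \<in> ?S" if st: "s \<in> ?S" "a \<in> carrier R" for s a
  proof -
    from st obtain x y where *: "s = x \<oplus> y" "x \<in> N" "y \<in> K" by blast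
    then have "s \<star> a = x \<star> a \<oplus> y \<star> a" using assms st submodD(3) by (simp add: ract_add)
    then show ?thesis using * assms st submodD(5) by blast
  qed
qed

text \<open>
  Submodules of \<open>E \<times> E\<close>.  Homomorphisms between submodules of \<open>E\<close> are handled through their graphs,
  which avoids functions with a restricted domain.
\<close>

definition linear_relation :: "('e \<times> 'e) set \<Rightarrow> bool" where
  "linear_relation G \<longleftrightarrow> G \<subseteq> carrier E \<times> carrier E \<and> (\<zero>, \<zero>) \<in> G \<and>
     (\<forall>x y x' y'. (x, y) \<in> G \<and> (x', y') \<in> G \<longrightarrow> (x \<oplus> x', y \<oplus> y') \<in> G) \<and>
     (\<forall>x y. \<forall>a\<in>carrier R. (x, y) \<in> G \<longrightarrow> (x \<star> a, y \<star> a) \<in> G)"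

lemma linear_relation_diff:
  assumes "linear_relation G" "(x, y) \<in> G" "(x', y') \<in> G"
  shows "(x \<ominus> x', y \<ominus> y') \<in> G"
proof -
  have c: "x' \<in> carrier E" "y' \<in> carrier E" using assms by (auto simp: linear_relation_def)
  have "(x' \<star> (\<ominus>\<^bsub>R\<^esub> \<one>\<^bsub>R\<^esub>), y' \<star> (\<ominus>\<^bsub>R\<^esub> \<one>\<^bsub>R\<^esub>)) \<in> G"
    using assms unfolding linear_relation_def by (meson R.one_closed R.a_inv_closed)
  then have "(\<ominus> x', \<ominus> y') \<in> G" using c by (simp add: ract_minus_one)
  then show ?thesis using assms unfolding linear_relation_def a_minus_def by blast
qed

text \<open>
  Injectivity of \<open>E\<close> in the form in which it is used throughout.
\<close>

lemma linear_relation_extends: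
  assumes G: "linear_relation G" and sv: "\<And>y. (\<zero>, y) \<in> G \<Longrightarrow> y = \<zero>"
  shows "\<exists>u. endo u \<and> (\<forall>x y. (x, y) \<in> G \<longrightarrow> u x = y)"
proof -
  define D where "D = Domain G"
  have Gc: "x \<in> carrier E" "y \<in> carrier E" if "(x, y) \<in> G" for x y
    using G that by (auto simp: linear_relation_def)
  have uniq: "y = y'" if "(x, y) \<in> G" "(x, y') \<in> G" for x y y'
  proof -
    have "(\<zero>, y \<ominus> y') \<in> G"
      using linear_relation_diff[OF G that] Gc[OF that(1)] by (simp add: a_minus_def M.r_neg)
    then have "y \<ominus> y' = \<zero>" by (rule sv)
    then show ?thesis using Gc(2)[OF that(1)] Gc(2)[OF that(2)] diff_zero_eq by blast
  qed
  define f where "f x = (THE y. (x, y) \<in> G)" for x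
  have f: "f x = y" if "(x, y) \<in> G" for x y
    unfolding f_def using that uniq by blast
  have D: "submod D"
    using G by (intro submodI) (auto simp: D_def linear_relation_def, blast+)
  let ?A = "E\<lparr>carrier := D\<rparr>"
  have "f \<in> rmod_hom R ?A E"
    unfolding rmod_hom_def
  proof (intro CollectI conjI Pi_I ballI)
    fix x assume "x \<in> carrier ?A"
    then show "f x \<in> carrier E" using f Gc by (force simp: D_def)
  next
    fix x y assume "x \<in> carrier ?A" "y \<in> carrier ?A"
    then obtain x' y' where *: "(x, x') \<in> G" "(y, y') \<in> G" by (auto simp: D_def)
    then have "(x \<oplus> y, x' \<oplus> y') \<in> G" using G by (auto simp: linear_relation_def)
    then show "f (x \<oplus>\<^bsub>?A\<^esub> y) = f x \<oplus> f y" using f * by auto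
  next
    fix x a assume "x \<in> carrier ?A" and a: "a \<in> carrier R"
    then obtain x' where *: "(x, x') \<in> G" by (auto simp: D_def)
    then have "(x \<star> a, x' \<star> a) \<in> G" using G a by (auto simp: linear_relation_def)
    then show "f (x \<star>\<^bsub>?A\<^esub> a) = f x \<star> a" using f * by auto
  qed
  moreover have "right_module R ?A" using D right_module_axioms by (rule right_module_rsubmodule[rotated])
  moreover have "(\<lambda>x. x) \<in> rmod_hom R ?A E" using D submodD(1) by (auto simp: rmod_hom_def)
  ultimately obtain h where h: "endo h" "\<forall>x\<in>carrier ?A. h x = f x"
    using injective[unfolded injective_rmod_def, rule_format, of ?A E "\<lambda>x. x" f]
      right_module_axioms by auto
  have "h x = y" if "(x, y) \<in> G" for x y
    using h(2) f[OF that] that by (auto simp: D_def)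
  then show ?thesis using h(1) by blast
qed

section \<open>Splittings of an injective module\<close>

text \<open>
  Essentiality inside a submodule \<open>P\<close>, expressed with submodules of \<open>E\<close> only, so that one
  notion of submodule serves for all \<open>P\<close>.
\<close>

definition ess_in :: "'e set \<Rightarrow> 'e set \<Rightarrow> bool" where
  "ess_in N P \<longleftrightarrow> submod N \<and> submod P \<and> N \<subseteq> P \<and>
     (\<forall>K. submod K \<and> K \<subseteq> P \<and> N \<inter> K = {\<zero>} \<longrightarrow> K = {\<zero>})"

text \<open>
  A pair of complementary idempotents.  Carrying both avoids subtraction in most calculations.
\<close>

definition splitting :: "('e \<Rightarrow> 'e) \<Rightarrow> ('e \<Rightarrow> 'e) \<Rightarrow> bool" where
  "splitting p q \<longleftrightarrow> endo p \<and> endo q \<and>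
     (\<forall>x\<in>carrier E. p x \<oplus> q x = x \<and> p (q x) = \<zero> \<and> q (p x) = \<zero>)"

definition rng :: "('e \<Rightarrow> 'e) \<Rightarrow> 'e set" where
  "rng p = p ` carrier E"

lemma ess_inD:
  assumes "ess_in N P"
  shows "submod N" "submod P" "N \<subseteq> P"
    "submod K \<Longrightarrow> K \<subseteq> P \<Longrightarrow> (\<And>x. x \<in> N \<Longrightarrow> x \<in> K \<Longrightarrow> x = \<zero>) \<Longrightarrow> K = {\<zero>}"
proof -
  show "submod N" "submod P" "N \<subseteq> P" using assms by (auto simp: ess_in_def)
  assume K: "submod K" "K \<subseteq> P" "\<And>x. x \<in> N \<Longrightarrow> x \<in> K \<Longrightarrow> x = \<zero>"
  have "\<zero> \<in> N \<inter> K" using K(1) \<open>submod N\<close> submodD(2) by auto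
  then have "N \<inter> K = {\<zero>}" using K(3) by blast
  then show "K = {\<zero>}" using K assms by (auto simp: ess_in_def)
qed

lemma submod_rng: "endo p \<Longrightarrow> submod (rng p)"
  unfolding rng_def by (rule submod_image[OF _ submod_carrier])

lemma submod_trivI:
  assumes "submod N" "\<And>x. x \<in> N \<Longrightarrow> x = \<zero>"
  shows "N = {\<zero>}"
  using assms submodD(2) by blast

lemma splitting_sym: "splitting p q \<Longrightarrow> splitting q p"
  by (auto simp: splitting_def endoD(1) M.a_comm[of "q _" "p _"])

lemma splittingD:
  assumes "splitting p q"
  shows "endo p" "endo q"
    "x \<in> carrier E \<Longrightarrow> p x \<in> carrier E" "x \<in> carrier E \<Longrightarrow> q x \<in> carrier E"
    "x \<in> carrier E \<Longrightarrow> p x \<oplus> q x = x"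
    "x \<in> carrier E \<Longrightarrow> p (q x) = \<zero>" "x \<in> carrier E \<Longrightarrow> q (p x) = \<zero>"
  using assms endoD(1) by (auto simp: splitting_def)

lemma splitting_idem:
  assumes "splitting p q" "x \<in> carrier E"
  shows "p (p x) = p x"
proof -
  note D = splittingD[OF assms(1)]
  have "p x = p (p x \<oplus> q x)" using D assms by simp
  also have "\<dots> = p (p x) \<oplus> p (q x)" using D(3,4) assms(2) by (simp add: endoD(2)[OF D(1)])
  also have "\<dots> = p (p x)" using D(3,6) assms(2) by simp
  finally show ?thesis by simp
qed

lemma splitting_rng:
  assumes "splitting p q"
  shows "rng p = {x \<in> carrier E. p x = x}" "rng p = {x \<in> carrier E. q x = \<zero>}"
proof -
  note D = splittingD[OF assms]
  show 1: "rng p = {x \<in> carrier E. p x = x}"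
  proof
    show "rng p \<subseteq> {x \<in> carrier E. p x = x}"
      using D(3) splitting_idem[OF assms] by (auto simp: rng_def)
    show "{x \<in> carrier E. p x = x} \<subseteq> rng p" by (force simp: rng_def)
  qed
  show "rng p = {x \<in> carrier E. q x = \<zero>}"
  proof
    show "rng p \<subseteq> {x \<in> carrier E. q x = \<zero>}" using D(3,7) by (auto simp: rng_def)
    show "{x \<in> carrier E. q x = \<zero>} \<subseteq> rng p"
      unfolding 1 using D(3,5) M.r_zero by force
  qed
qed

lemma submod_chain_Union:
  assumes ne: "Cs \<noteq> {}" and sub: "\<And>A. A \<in> Cs \<Longrightarrow> submod A"
    and tot: "\<And>A B. A \<in> Cs \<Longrightarrow> B \<in> Cs \<Longrightarrow> A \<subseteq> B \<or> B \<subseteq> A"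
  shows "submod (\<Union>Cs)"
proof (rule submodI)
  show "\<Union>Cs \<subseteq> carrier E" using sub submodD(1) by blast
  show "\<zero> \<in> \<Union>Cs" using ne sub submodD(2) by blast
  show "x \<oplus> y \<in> \<Union>Cs" if xy: "x \<in> \<Union>Cs" "y \<in> \<Union>Cs" for x y
  proof -
    from xy obtain A B where AB: "A \<in> Cs" "B \<in> Cs" "x \<in> A" "y \<in> B" by blast
    then obtain L where "L \<in> Cs" "x \<in> L" "y \<in> L" using tot by blast
    then show ?thesis using submodD(4)[OF sub] by blast
  qed
  show "x \<star> a \<in> \<Union>Cs" if "x \<in> \<Union>Cs" "a \<in> carrier R" for x a
    using that submodD(5)[OF sub] by blast
qed

lemma exists_complement:
  assumes N: "submod N" and K: "submod K" and NK: "N \<inter> K = {\<zero>}"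
  shows "\<exists>C. submod C \<and> K \<subseteq> C \<and> N \<inter> C = {\<zero>} \<and>
    (\<forall>L. submod L \<longrightarrow> C \<subseteq> L \<longrightarrow> N \<inter> L = {\<zero>} \<longrightarrow> L = C)"
proof -
  define S where "S = {C. submod C \<and> K \<subseteq> C \<and> N \<inter> C = {\<zero>}}"
  have "\<exists>C\<in>S. \<forall>L\<in>S. C \<subseteq> L \<longrightarrow> L = C"
  proof (rule subset_Zorn_nonempty)
    show "S \<noteq> {}" using assms by (auto simp: S_def)
    fix Cs assume ne: "Cs \<noteq> {}" and ch: "subset.chain S Cs"
    then have sub: "Cs \<subseteq> S" and tot: "\<And>A B. A \<in> Cs \<Longrightarrow> B \<in> Cs \<Longrightarrow> A \<subseteq> B \<or> B \<subseteq> A"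
      by (auto simp: subset_chain_def)
    have "submod (\<Union>Cs)"
      by (rule submod_chain_Union[OF ne _ tot]) (use sub in \<open>auto simp: S_def\<close>)
    then show "\<Union>Cs \<in> S" using ne sub by (auto simp: S_def)
  qed
  then obtain C where C: "C \<in> S" "\<forall>L\<in>S. C \<subseteq> L \<longrightarrow> L = C" by blast
  have "L = C" if "submod L" "C \<subseteq> L" "N \<inter> L = {\<zero>}" for L
    using C that by (auto simp: S_def)
  then show ?thesis using C(1) unfolding S_def by blast
qed

text \<open>
  An injective module contains an envelope of each submodule \<open>N\<close> as a direct summand, and the
  complementary summand may be chosen to contain any \<open>K\<close> that meets \<open>N\<close> trivially.
  If \<open>C \<supseteq> K\<close> is a maximal complement of \<open>N\<close>, and \<open>P \<supseteq> N\<close> is a maximal complement of \<open>C\<close>, then the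
  projection \<open>P + C \<rightarrow> P\<close> extends to an endomorphism \<open>h\<close> of \<open>E\<close>.  Maximality of \<open>C\<close> makes \<open>N\<close>
  essential in \<open>hE\<close>, and then maximality of \<open>P\<close> forces \<open>hE = P\<close>, so \<open>h\<close> is idempotent.
\<close>

lemma exists_splitting:
  assumes N: "submod N" and K: "submod K" and NK: "\<And>x. x \<in> N \<Longrightarrow> x \<in> K \<Longrightarrow> x = \<zero>"
  shows "\<exists>p q. splitting p q \<and> ess_in N (rng p) \<and> (\<forall>x\<in>K. p x = \<zero>)"
proof -
  have "N \<inter> K = {\<zero>}" using N K NK submodD(2) by blast
  then obtain C where C: "submod C" "K \<subseteq> C" "N \<inter> C = {\<zero>}"
    and Cmax: "\<And>L. submod L \<Longrightarrow> C \<subseteq> L \<Longrightarrow> N \<inter> L = {\<zero>} \<Longrightarrow> L = C"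
    using exists_complement[OF N K] by blast
  have "C \<inter> N = {\<zero>}" using C(3) by blast
  then obtain P where P: "submod P" "N \<subseteq> P" "C \<inter> P = {\<zero>}"
    and Pmax: "\<And>L. submod L \<Longrightarrow> P \<subseteq> L \<Longrightarrow> C \<inter> L = {\<zero>} \<Longrightarrow> L = P"
    using exists_complement[OF C(1) N] by blast
  have CP: "x = \<zero>" if "x \<in> C" "x \<in> P" for x using that P(3) by blast
  let ?G = "{(x \<oplus> y, x) | x y. x \<in> P \<and> y \<in> C}"
  have c: "x \<in> carrier E" if "x \<in> P \<or> x \<in> C" for x
    using that submodD(3)[OF P(1)] submodD(3)[OF C(1)] by blast
  have "linear_relation ?G"
    unfolding linear_relation_def
  proof (intro conjI allI impI ballI)
    show "?G \<subseteq> carrier E \<times> carrier E" using c by auto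
    show "(\<zero>, \<zero>) \<in> ?G" using submodD(2)[OF P(1)] submodD(2)[OF C(1)] by (force intro!: exI[of _ "\<zero>"])
  next
    fix s t s' t' assume "(s, t) \<in> ?G \<and> (s', t') \<in> ?G"
    then obtain y y' where *: "s = t \<oplus> y" "t \<in> P" "y \<in> C" "s' = t' \<oplus> y'" "t' \<in> P" "y' \<in> C"
      by blast
    then have "s \<oplus> s' = (t \<oplus> t') \<oplus> (y \<oplus> y')" using c by (simp add: M.a_ac)
    moreover have "t \<oplus> t' \<in> P" "y \<oplus> y' \<in> C"
      using * submodD(4)[OF P(1)] submodD(4)[OF C(1)] by simp_all
    ultimately show "(s \<oplus> s', t \<oplus> t') \<in> ?G" by blast
  next
    fix s t a assume a: "a \<in> carrier R" and "(s, t) \<in> ?G"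
    then obtain y where *: "s = t \<oplus> y" "t \<in> P" "y \<in> C" by blast
    then have "s \<star> a = t \<star> a \<oplus> y \<star> a" using a c by (simp add: ract_add)
    moreover have "t \<star> a \<in> P" "y \<star> a \<in> C"
      using * a submodD(5)[OF P(1)] submodD(5)[OF C(1)] by simp_all
    ultimately show "(s \<star> a, t \<star> a) \<in> ?G" by blast
  qed
  moreover have "t = \<zero>" if t: "(\<zero>, t) \<in> ?G" for t
  proof -
    obtain y where y: "t \<oplus> y = \<zero>" "t \<in> P" "y \<in> C" using t by force
    then have "\<ominus> t = y" using c M.minus_equality[of y t] M.a_comm[of y t] by simp
    then have "y \<in> P" using submod_minus[OF P(1) y(2)] by simp
    then have "y = \<zero>" using y CP by blast
    then show ?thesis using y c by simp
  qed
  ultimately obtain h where h: "endo h" and hG: "\<And>s t. (s, t) \<in> ?G \<Longrightarrow> h s = t"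
    using linear_relation_extends[of ?G] by blast
  have hG': "h (x \<oplus> y) = x" if "x \<in> P" "y \<in> C" for x y
    using hG[of "x \<oplus> y" x] that by blast
  have hP: "h x = x" if "x \<in> P" for x
    using hG'[OF that submodD(2)[OF C(1)]] that c by simp
  have hC: "h x = \<zero>" if "x \<in> C" for x
    using hG'[OF submodD(2)[OF P(1)] that] that c by simp
  have Pr: "P \<subseteq> rng h" using hP c by (force simp: rng_def)
  have ess: "\<exists>n\<in>N. n \<in> L \<and> n \<noteq> \<zero>" if L: "submod L" "L \<subseteq> rng h" "L \<noteq> {\<zero>}" for L
  proof (rule ccontr)
    assume no: "\<not> ?thesis"
    let ?L = "{x \<in> carrier E. h x \<in> L}"
    have sL: "submod ?L" using submod_vimage[OF h L(1)] .
    have "C \<subseteq> ?L" using c hC L(1) submodD(2) by auto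
    moreover have "N \<inter> ?L = {\<zero>}"
    proof
      show "N \<inter> ?L \<subseteq> {\<zero>}" using no hP P(2) by fastforce
      show "{\<zero>} \<subseteq> N \<inter> ?L" using N sL submodD(2) by blast
    qed
    ultimately have "?L = C" using Cmax sL by blast
    then have "h x = \<zero>" if "x \<in> carrier E" "h x \<in> L" for x using that hC by blast
    then have "L \<subseteq> {\<zero>}" using L(2) by (auto simp: rng_def)
    then show False using L submodD(2) by blast
  qed
  have "C \<inter> rng h = {\<zero>}"
  proof (rule ccontr)
    assume ne: "\<not> ?thesis"
    have "submod (C \<inter> rng h)" using submod_Int C(1) submod_rng[OF h] by blast
    then obtain n where "n \<in> N" "n \<in> C" "n \<noteq> \<zero>" using ess[of "C \<inter> rng h"] ne by blast
    then show False using C(3) by blast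
  qed
  then have rP: "rng h = P" using Pmax submod_rng[OF h] Pr by blast
  let ?q = "\<lambda>x. x \<ominus> h x"
  have hh: "h (h x) = h x" if "x \<in> carrier E" for x
    using hP rP that by (auto simp: rng_def)
  have hc: "h x \<in> carrier E" if "x \<in> carrier E" for x using h that endoD(1) by simp
  have q: "endo ?q" by (rule endo_subtract[OF endo_id h])
  have "splitting h ?q"
    unfolding splitting_def
  proof (intro conjI ballI h q)
    fix x assume x: "x \<in> carrier E"
    show "h x \<oplus> (x \<ominus> h x) = x" using x hc by (simp add: a_minus_def M.a_ac M.r_neg2 M.r_neg)
    show "h (x \<ominus> h x) = \<zero>" using x hc endo_diff[OF h] hh by (simp add: a_minus_def M.r_neg)
    show "h x \<ominus> h (h x) = \<zero>" using x hc hh by (simp add: a_minus_def M.r_neg)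
  qed
  moreover have "ess_in N (rng h)"
    unfolding ess_in_def using N submod_rng[OF h] Pr P(2) ess by blast
  ultimately show ?thesis using hC C(2) by blast
qed

section \<open>Maps that preserve an automorphism-invariant submodule\<close>

definition aut_invariant :: "'e set \<Rightarrow> bool" where
  "aut_invariant M \<longleftrightarrow> submod M \<and> (\<forall>\<phi>\<in>rmod_aut R E. \<phi> ` M \<subseteq> M)"

definition splitting_invariant :: "'e set \<Rightarrow> bool" where
  "splitting_invariant M \<longleftrightarrow> (\<forall>p q. splitting p q \<longrightarrow> p ` M \<subseteq> M)"

lemma aut_invariantD:
  assumes "aut_invariant M" "\<phi> \<in> rmod_aut R E" "x \<in> M"
  shows "\<phi> x \<in> M"
  using assms by (auto simp: aut_invariant_def)

lemma splitting_invariantD: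
  assumes "splitting_invariant M" "splitting p q" "x \<in> M"
  shows "p x \<in> M" "q x \<in> M"
  using assms splitting_sym[OF assms(2)] unfolding splitting_invariant_def by blast+

lemma diff_self: "x \<in> carrier E \<Longrightarrow> x \<ominus> x = \<zero>"
  by (simp add: a_minus_def M.r_neg)

lemma diff_zero: "x \<in> carrier E \<Longrightarrow> x \<ominus> \<zero> = x"
  by (simp add: a_minus_def)

lemma rmod_autI:
  assumes f: "endo f" and inj: "\<And>x. x \<in> carrier E \<Longrightarrow> f x = \<zero> \<Longrightarrow> x = \<zero>"
    and surj: "\<And>y. y \<in> carrier E \<Longrightarrow> \<exists>x\<in>carrier E. f x = y"
  shows "f \<in> rmod_aut R E"
proof -
  have "inj_on f (carrier E)"
  proof (rule inj_onI)
    fix x y assume xy: "x \<in> carrier E" "y \<in> carrier E" "f x = f y"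
    then have "f (x \<ominus> y) = \<zero>"
      using endoD(1)[OF f] by (simp add: endo_diff[OF f] diff_self)
    then have "x \<ominus> y = \<zero>" using inj xy by simp
    then show "x = y" using diff_zero_eq xy by blast
  qed
  moreover have "f ` carrier E = carrier E"
  proof
    show "f ` carrier E \<subseteq> carrier E" using endoD(1)[OF f] by blast
    show "carrier E \<subseteq> f ` carrier E" using surj by blast
  qed
  ultimately show ?thesis using f by (simp add: rmod_aut_def bij_betw_def)
qed

text \<open>
  The correspondence \<open>f x \<mapsto> g x\<close> on \<open>f D\<close> is a well-defined homomorphism, so it extends to \<open>E\<close>.
\<close>

lemma endo_factor:
  assumes f: "endo f" and g: "endo g" and D: "submod D"
    and ker: "\<And>x. x \<in> D \<Longrightarrow> f x = \<zero> \<Longrightarrow> g x = \<zero>"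
  shows "\<exists>u. endo u \<and> (\<forall>x\<in>D. u (f x) = g x)"
proof -
  let ?G = "(\<lambda>x. (f x, g x)) ` D"
  have c: "x \<in> carrier E" if "x \<in> D" for x using that D submodD(3) by blast
  have "linear_relation ?G"
    unfolding linear_relation_def
  proof (intro conjI allI impI ballI)
    show "?G \<subseteq> carrier E \<times> carrier E" using c f g endoD(1) by auto
    show "(\<zero>, \<zero>) \<in> ?G"
      by (rule image_eqI[of _ _ "\<zero>"]) (simp_all add: submodD(2)[OF D] endo_zero[OF f] endo_zero[OF g])
  next
    fix s t s' t' assume "(s, t) \<in> ?G \<and> (s', t') \<in> ?G"
    then obtain x x' where *: "s = f x" "t = g x" "x \<in> D" "s' = f x'" "t' = g x'" "x' \<in> D" by blast
    then have "x \<oplus> x' \<in> D" "s \<oplus> s' = f (x \<oplus> x')" "t \<oplus> t' = g (x \<oplus> x')"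
      using submodD(4)[OF D] c endoD(2)[OF f] endoD(2)[OF g] by simp_all
    then show "(s \<oplus> s', t \<oplus> t') \<in> ?G" by simp
  next
    fix s t a assume a: "a \<in> carrier R" and "(s, t) \<in> ?G"
    then obtain x where *: "s = f x" "t = g x" "x \<in> D" by blast
    then have "x \<star> a \<in> D" "s \<star> a = f (x \<star> a)" "t \<star> a = g (x \<star> a)"
      using a submodD(5)[OF D] c endoD(3)[OF f] endoD(3)[OF g] by simp_all
    then show "(s \<star> a, t \<star> a) \<in> ?G" by simp
  qed
  moreover have "y = \<zero>" if "(\<zero>, y) \<in> ?G" for y
  proof -
    from that obtain x where "x \<in> D" "\<zero> = f x" "y = g x" by blast
    then show ?thesis using ker[of x] by metis
  qed
  ultimately obtain u where "endo u" "\<forall>x y. (x, y) \<in> ?G \<longrightarrow> u x = y"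
    using linear_relation_extends[of ?G] by blast
  then show ?thesis by (intro exI[of _ u]) blast
qed

text \<open>
  The map \<open>1 + h\<close> is an automorphism with inverse \<open>1 - h\<close>.
\<close>

lemma square_zero_preserves:
  assumes M: "aut_invariant M" and h: "endo h" and hh: "\<And>x. x \<in> carrier E \<Longrightarrow> h (h x) = \<zero>"
    and x: "x \<in> M"
  shows "h x \<in> M"
proof -
  have sM: "submod M" using M by (simp add: aut_invariant_def)
  have hc: "h x \<in> carrier E" if "x \<in> carrier E" for x using h that endoD(1) by blast
  let ?f = "\<lambda>x. x \<oplus> h x"
  have f: "endo ?f" by (intro endo_add endo_id h)
  have "?f \<in> rmod_aut R E"
  proof (rule rmod_autI[OF f])
    fix x assume x: "x \<in> carrier E" and "x \<oplus> h x = \<zero>"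
    then have "h (x \<oplus> h x) = \<zero>" using endo_zero[OF h] by simp
    then have "h x = \<zero>" using x hc hh by (simp add: endoD(2)[OF h])
    then show "x = \<zero>" using \<open>x \<oplus> h x = \<zero>\<close> x by simp
  next
    fix y assume y: "y \<in> carrier E"
    then have "h (y \<ominus> h y) = h y"
      using hc hh by (simp add: endo_diff[OF h] diff_zero)
    then have "?f (y \<ominus> h y) = y" using y hc by (simp add: a_minus_def M.a_assoc M.l_neg)
    then show "\<exists>x\<in>carrier E. ?f x = y" using y hc by blast
  qed
  from aut_invariantD[OF M this x] have "?f x \<in> M" .
  then show ?thesis using submod_cancel[OF sM x] hc submodD(3)[OF sM x] by blast
qed

lemma offdiagonal_preserves:
  assumes M: "aut_invariant M" and p: "endo p" and q: "endo q" and f: "endo f"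
    and qp: "\<And>x. x \<in> carrier E \<Longrightarrow> q (p x) = \<zero>" and x: "x \<in> M"
  shows "p (f (q x)) \<in> M"
proof (rule square_zero_preserves[OF M _ _ x])
  show "endo (\<lambda>x. p (f (q x)))" by (rule endo_comp[OF p endo_comp[OF f q]])
  show "p (f (q (p (f (q x))))) = \<zero>" if "x \<in> carrier E" for x
    using that qp endoD(1)[OF f] endoD(1)[OF q] endo_zero[OF f] endo_zero[OF p] by simp
qed

text \<open>
  A one-to-one endomorphism \<open>g\<close> of the injective module \<open>pE\<close> has a left inverse, so its range splits
  off from \<open>pE\<close>.  A complement \<open>D\<close> of the range is disjoint from \<open>g D\<close>, so it vanishes by
  hypothesis.
\<close>

lemma injective_block_surjective:
  assumes pq: "splitting p q" and g: "endo g" and gp: "\<And>x. x \<in> rng p \<Longrightarrow> g x \<in> rng p"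
    and inj: "\<And>x. x \<in> rng p \<Longrightarrow> g x = \<zero> \<Longrightarrow> x = \<zero>"
    and disj: "\<And>D. submod D \<Longrightarrow> D \<subseteq> rng p \<Longrightarrow> D \<inter> g ` D = {\<zero>} \<Longrightarrow> D = {\<zero>}"
    and y: "y \<in> rng p"
  shows "\<exists>x\<in>rng p. g x = y"
proof -
  note pe = splittingD(1)[OF pq]
  note sp = submod_rng[OF pe]
  have c: "x \<in> carrier E" if "x \<in> rng p" for x using that sp submodD(3) by blast
  have pr: "p x \<in> rng p" if "x \<in> carrier E" for x using that by (auto simp: rng_def)
  have "\<exists>k. endo k \<and> (\<forall>x\<in>rng p. k (g x) = x)"
    by (rule endo_factor[OF g endo_id sp]) (rule inj)
  then obtain k where k: "endo k" and kg: "\<forall>x\<in>rng p. k (g x) = x" by blast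
  define u where "u = (\<lambda>x. g (p (k x)))"
  have u: "endo u" unfolding u_def by (rule endo_comp[OF g endo_comp[OF pe k]])
  have ug: "u (g x) = g x" if "x \<in> rng p" for x
  proof -
    have "k (g x) = x" using kg that by blast
    moreover have "p x = x" using that splitting_rng(1)[OF pq] by blast
    ultimately show ?thesis by (simp add: u_def)
  qed
  have up: "u x \<in> rng p" if "x \<in> carrier E" for x
    using that gp pr endoD(1)[OF k] by (simp add: u_def)
  have uu: "u (u x) = u x" if "x \<in> carrier E" for x
    using ug[of "p (k x)"] pr that endoD(1)[OF k] by (simp add: u_def)
  let ?D = "rng p \<inter> {x \<in> carrier E. u x = \<zero>}"
  have sD: "submod ?D" using submod_Int sp submod_ker[OF u] by blast
  have "?D \<inter> g ` ?D = {\<zero>}"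
  proof
    show "?D \<inter> g ` ?D \<subseteq> {\<zero>}"
    proof
      fix x assume "x \<in> ?D \<inter> g ` ?D"
      then obtain z where "u x = \<zero>" "z \<in> rng p" "x = g z" by blast
      then show "x \<in> {\<zero>}" using ug[of z] by simp
    qed
    show "{\<zero>} \<subseteq> ?D \<inter> g ` ?D" using submodD(2)[OF sD] submodD(2)[OF submod_image[OF g sD]] by simp
  qed
  then have D: "?D = {\<zero>}" using disj[OF sD] by blast
  have yc: "y \<in> carrier E" using c y by blast
  have "y \<ominus> u y \<in> rng p" using submod_diff[OF sp y] up yc by blast
  moreover have "u (y \<ominus> u y) = \<zero>"
    using yc uu endoD(1)[OF u] by (simp add: endo_diff[OF u] diff_self)
  ultimately have "y \<ominus> u y \<in> ?D" using c by blast
  then have "y \<ominus> u y = \<zero>" using D by blast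
  then have "y = u y" using diff_zero_eq yc endoD(1)[OF u] by blast
  then have "g (p (k y)) = y" by (simp add: u_def)
  moreover have "p (k y) \<in> rng p" using pr yc endoD(1)[OF k] by blast
  ultimately show ?thesis by blast
qed

lemma block_automorphism:
  assumes pq: "splitting p q" and g: "endo g" and gp: "\<And>x. x \<in> rng p \<Longrightarrow> g x \<in> rng p"
    and inj: "\<And>x. x \<in> rng p \<Longrightarrow> g x = \<zero> \<Longrightarrow> x = \<zero>"
    and disj: "\<And>D. submod D \<Longrightarrow> D \<subseteq> rng p \<Longrightarrow> D \<inter> g ` D = {\<zero>} \<Longrightarrow> D = {\<zero>}"
  shows "(\<lambda>x. g (p x) \<oplus> q x) \<in> rmod_aut R E" (is "?f \<in> _")
proof -
  note D = splittingD[OF pq]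
  note gc = endoD(1)[OF g]
  have pr: "p x \<in> rng p" if "x \<in> carrier E" for x using that by (auto simp: rng_def)
  have pg: "p (g (p x)) = g (p x)" "q (g (p x)) = \<zero>" if "x \<in> carrier E" for x
    using gp[OF pr[OF that]] splitting_rng[OF pq] by auto
  have qq: "q (q x) = q x" if "x \<in> carrier E" for x
    using splitting_idem[OF splitting_sym[OF pq]] that by blast
  show ?thesis
  proof (rule rmod_autI)
    show "endo ?f" by (rule endo_add[OF endo_comp[OF g D(1)] D(2)])
  next
    fix x assume x: "x \<in> carrier E" and 0: "g (p x) \<oplus> q x = \<zero>"
    have "p (g (p x) \<oplus> q x) = g (p x)"
      using x D gc pg by (simp add: endoD(2)[OF D(1)])
    then have "g (p x) = \<zero>" using 0 endo_zero[OF D(1)] by simp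
    then have px: "p x = \<zero>" using inj pr x by blast
    have "q (g (p x) \<oplus> q x) = q x"
      using x D gc pg qq by (simp add: endoD(2)[OF D(2)])
    then have "q x = \<zero>" using 0 endo_zero[OF D(2)] by simp
    then show "x = \<zero>" using D(5)[OF x] px by simp
  next
    fix y assume y: "y \<in> carrier E"
    have "\<exists>x\<in>rng p. g x = p y"
      by (rule injective_block_surjective[OF pq g gp inj disj pr[OF y]])
    then obtain z where z: "z \<in> rng p" "g z = p y" by blast
    have zc: "z \<in> carrier E" "p z = z" "q z = \<zero>" using z splitting_rng[OF pq] by auto
    have "p (z \<oplus> q y) = z" "q (z \<oplus> q y) = q y"
      using zc y D qq by (simp_all add: endoD(2)[OF D(1)] endoD(2)[OF D(2)])
    then have "?f (z \<oplus> q y) = y" using z(2) D(5)[OF y] by simp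
    then show "\<exists>x\<in>carrier E. ?f x = y" using zc y D by blast
  qed
qed

lemma block_preserves:
  assumes M: "aut_invariant M" "splitting_invariant M"
    and pq: "splitting p q" and g: "endo g" and gp: "\<And>x. x \<in> rng p \<Longrightarrow> g x \<in> rng p"
    and inj: "\<And>x. x \<in> rng p \<Longrightarrow> g x = \<zero> \<Longrightarrow> x = \<zero>"
    and disj: "\<And>D. submod D \<Longrightarrow> D \<subseteq> rng p \<Longrightarrow> D \<inter> g ` D = {\<zero>} \<Longrightarrow> D = {\<zero>}"
    and x: "x \<in> M"
  shows "g (p x) \<in> M"
proof -
  have sM: "submod M" using M by (simp add: aut_invariant_def)
  note xc = submodD(3)[OF sM x]
  have qx: "q x \<in> M" using splitting_invariantD(2)[OF M(2) pq x] .
  have gpx: "g (p x) \<in> carrier E" using endoD(1) g splittingD(1)[OF pq] xc by simp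
  have "g (p x) \<oplus> q x \<in> M"
    using aut_invariantD[OF M(1) block_automorphism[OF pq g gp inj disj] x] .
  then have "q x \<oplus> g (p x) \<in> M" using M.a_comm gpx splittingD(4)[OF pq xc] by simp
  then show ?thesis using submod_cancel[OF sM qx] gpx by blast
qed

text \<open>
  If \<open>j\<close> has essential kernel, then \<open>1 + j\<close> is an automorphism: it is the identity on the kernel of
  \<open>j\<close>, which makes it one-to-one, and which prevents any nonzero \<open>D\<close> from being disjoint from its
  image, as \<open>D\<close> and the kernel of \<open>j\<close> have a nonzero element in common.
\<close>

lemma essential_kernel_preserves:
  assumes M: "aut_invariant M" and j: "endo j"
    and ess: "\<And>K. submod K \<Longrightarrow> (\<And>x. x \<in> K \<Longrightarrow> j x = \<zero> \<Longrightarrow> x = \<zero>) \<Longrightarrow> K = {\<zero>}"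
    and x: "x \<in> M"
  shows "j x \<in> M"
proof -
  have sM: "submod M" using M by (simp add: aut_invariant_def)
  note jc = endoD(1)[OF j]
  let ?g = "\<lambda>x. x \<oplus> j x"
  have g: "endo ?g" by (intro endo_add endo_id j)
  have id: "splitting (\<lambda>x. x) (\<lambda>x. \<zero>)"
    by (simp add: splitting_def endo_id endo_const_zero)
  have r: "rng (\<lambda>x. x) = carrier E" by (simp add: rng_def)
  have "(\<lambda>x. ?g x \<oplus> \<zero>) \<in> rmod_aut R E"
  proof (rule block_automorphism[OF id g])
    show "?g x \<in> rng (\<lambda>x. x)" if "x \<in> rng (\<lambda>x. x)" for x using that jc by (simp add: r)
  next
    fix x assume x: "x \<in> rng (\<lambda>x. x)" "?g x = \<zero>"
    have "{x \<in> carrier E. ?g x = \<zero>} = {\<zero>}"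
      by (rule ess[OF submod_ker[OF g]]) auto
    then show "x = \<zero>" using x by (auto simp: r)
  next
    fix D assume D: "submod D" "D \<inter> ?g ` D = {\<zero>}"
    show "D = {\<zero>}"
    proof (rule ess[OF D(1)])
      fix x assume x: "x \<in> D" "j x = \<zero>"
      then have "?g x = x" using submodD(3)[OF D(1)] by simp
      then have "x \<in> ?g ` D" using x(1) by force
      then show "x = \<zero>" using D(2) x(1) by blast
    qed
  qed
  from aut_invariantD[OF M this x] have "?g x \<oplus> \<zero> \<in> M" .
  then have "?g x \<in> M" using jc submodD(3)[OF sM x] by simp
  then show ?thesis using submod_cancel[OF sM x] jc submodD(3)[OF sM x] by blast
qed

text \<open>
  An endomorphism \<open>j = j p\<close> that vanishes on an essential submodule \<open>A\<close> of \<open>pE\<close> vanishes on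
  \<open>A \<oplus> qE\<close>, so its kernel is essential.
\<close>

lemma kernel_essential:
  assumes pq: "splitting p q" and A: "ess_in A (rng p)" and j: "endo j"
    and jA: "\<And>x. x \<in> A \<Longrightarrow> j x = \<zero>" and jp: "\<And>x. x \<in> carrier E \<Longrightarrow> j (p x) = j x"
    and K: "submod K" and inj: "\<And>x. x \<in> K \<Longrightarrow> j x = \<zero> \<Longrightarrow> x = \<zero>"
  shows "K = {\<zero>}"
proof -
  note pe = splittingD(1)[OF pq]
  have c: "x \<in> carrier E" if "x \<in> K" for x using that K submodD(3) by blast
  have "p ` K = {\<zero>}"
  proof (rule ess_inD(4)[OF A submod_image[OF pe K]])
    show "p ` K \<subseteq> rng p" using c by (auto simp: rng_def)
    fix y assume y: "y \<in> A" "y \<in> p ` K"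
    then obtain x where x: "x \<in> K" "y = p x" by blast
    then have "j x = \<zero>" using jA[OF y(1)] jp c by simp
    then have "x = \<zero>" using inj x(1) by blast
    then show "y = \<zero>" using x(2) endo_zero[OF pe] by simp
  qed
  then have "x = \<zero>" if "x \<in> K" for x
    using that inj jp[OF c[OF that]] endo_zero[OF j] by (metis imageI singletonD)
  then show ?thesis using submod_trivI K by blast
qed

section \<open>CS submodules are invariant under idempotents\<close>

definition CS_submodule :: "'e set \<Rightarrow> bool" where
  "CS_submodule M \<longleftrightarrow> (\<forall>N. submod N \<and> N \<subseteq> M \<longrightarrow>
     (\<exists>D C. submod D \<and> submod C \<and> D \<subseteq> M \<and> C \<subseteq> M \<and> D \<inter> C = {\<zero>} \<and>
        (\<forall>x\<in>M. \<exists>d\<in>D. \<exists>c\<in>C. x = d \<oplus> c) \<and> ess_in N D))"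

text \<open>
  Since \<open>p\<close> is one-to-one on \<open>D\<close>, the submodule \<open>D\<close> is the graph of a homomorphism from \<open>p D\<close> to
  \<open>qE\<close>.  It extends to an off-diagonal map of \<open>E\<close> that sends \<open>x \<in> D\<close> to \<open>q x\<close>.
\<close>

lemma components_in:
  assumes M: "aut_invariant M" and pq: "splitting p q" and D: "submod D" "D \<subseteq> M"
    and inj: "\<And>x. x \<in> D \<Longrightarrow> p x = \<zero> \<Longrightarrow> x = \<zero>" and x: "x \<in> D"
  shows "p x \<in> M" "q x \<in> M"
proof -
  have sM: "submod M" using M by (simp add: aut_invariant_def)
  note S = splittingD[OF pq]
  have xc: "x \<in> carrier E" using x D submodD(3) by blast
  have "\<exists>u. endo u \<and> (\<forall>x\<in>D. u (p x) = q x)"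
    by (rule endo_factor[OF S(1,2) D(1)]) (use inj endo_zero[OF S(2)] in blast)
  then obtain u where u: "endo u" "u (p x) = q x" using x by blast
  have "q (u (p x)) \<in> M"
    using offdiagonal_preserves[OF M S(2,1) u(1) S(6)] x D(2) by blast
  then show q: "q x \<in> M" using u(2) splitting_idem[OF splitting_sym[OF pq] xc] by simp
  have "q x \<oplus> p x \<in> M" using S(3,4,5)[OF xc] M.a_comm x D(2) by auto
  then show "p x \<in> M" using submod_cancel[OF sM q] S(3)[OF xc] by blast
qed

text \<open>
  Let \<open>M = D \<oplus> C\<close> with \<open>M \<inter> pE\<close> essential in \<open>D\<close>.  Then \<open>p\<close> is one-to-one on \<open>D\<close>, as the kernel of
  \<open>p\<close> misses the essential submodule \<open>M \<inter> pE\<close>, and \<open>q\<close> is one-to-one on \<open>C\<close>, as \<open>C\<close> misses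
  \<open>M \<inter> pE\<close>.  So \<open>components_in\<close> applies to both summands.
\<close>

lemma CS_splitting_invariant:
  assumes M: "aut_invariant M" and CS: "CS_submodule M"
  shows "splitting_invariant M"
  unfolding splitting_invariant_def
proof (intro allI impI image_subsetI)
  fix p q x assume pq: "splitting p q" and x: "x \<in> M"
  have sM: "submod M" using M by (simp add: aut_invariant_def)
  note S = splittingD[OF pq]
  note pr = splitting_rng[OF pq]
  let ?N = "M \<inter> rng p"
  have sN: "submod ?N" using submod_Int sM submod_rng[OF S(1)] by blast
  have "submod ?N \<and> ?N \<subseteq> M" using sN by blast
  from CS[unfolded CS_submodule_def, rule_format, OF this]
  obtain D C where D: "submod D" "D \<subseteq> M" and C: "submod C" "C \<subseteq> M"
    and DC: "D \<inter> C = {\<zero>}" and sum: "\<forall>x\<in>M. \<exists>d\<in>D. \<exists>c\<in>C. x = d \<oplus> c"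
    and ess: "ess_in ?N D"
    by (elim exE conjE)
  have p0: "z = \<zero>" if "p z = \<zero>" "z \<in> rng p" for z using that pr(1) by simp
  have "z = \<zero>" if z: "z \<in> D" "p z = \<zero>" for z
  proof -
    have "D \<inter> {x \<in> carrier E. p x = \<zero>} = {\<zero>}"
      by (rule ess_inD(4)[OF ess submod_Int[OF D(1) submod_ker[OF S(1)]]]) (use p0 in auto)
    then show ?thesis using z submodD(3)[OF D(1)] by blast
  qed
  then have pD: "p d \<in> M" if "d \<in> D" for d
    using components_in(1)[OF M pq D _ that] by blast
  have "z = \<zero>" if z: "z \<in> C" "q z = \<zero>" for z
  proof -
    have "z \<in> rng p" using z C submodD(3) pr(2) by blast
    then have "z \<in> ?N" using z C by blast
    then show ?thesis using z ess_inD(3)[OF ess] DC by blast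
  qed
  then have pC: "p c \<in> M" if "c \<in> C" for c
    using components_in(2)[OF M splitting_sym[OF pq] C _ that] by blast
  obtain d c where "d \<in> D" "c \<in> C" "x = d \<oplus> c" using sum x by blast
  moreover have "d \<in> carrier E" "c \<in> carrier E"
    using calculation submodD(3)[OF D(1)] submodD(3)[OF C(1)] by auto
  ultimately show "p x \<in> M"
    using endoD(2)[OF S(1)] submodD(4)[OF sM] pD pC by simp
qed

section \<open>Automorphisms and idempotents suffice\<close>

definition split3 :: "('e \<Rightarrow> 'e) \<Rightarrow> ('e \<Rightarrow> 'e) \<Rightarrow> ('e \<Rightarrow> 'e) \<Rightarrow> bool" where
  "split3 p q r \<longleftrightarrow> endo p \<and> endo q \<and> endo r \<and>
     (\<forall>x\<in>carrier E. p x \<oplus> (q x \<oplus> r x) = x \<and> p (q x) = \<zero> \<and> q (p x) = \<zero> \<and>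
        p (r x) = \<zero> \<and> r (p x) = \<zero> \<and> q (r x) = \<zero> \<and> r (q x) = \<zero>)"

lemma split3D:
  assumes "split3 p q r"
  shows "endo p" "endo q" "endo r" "x \<in> carrier E \<Longrightarrow> p x \<in> carrier E"
    "x \<in> carrier E \<Longrightarrow> q x \<in> carrier E" "x \<in> carrier E \<Longrightarrow> r x \<in> carrier E"
    "x \<in> carrier E \<Longrightarrow> p x \<oplus> (q x \<oplus> r x) = x"
    "x \<in> carrier E \<Longrightarrow> p (q x) = \<zero>" "x \<in> carrier E \<Longrightarrow> q (p x) = \<zero>"
    "x \<in> carrier E \<Longrightarrow> p (r x) = \<zero>" "x \<in> carrier E \<Longrightarrow> r (p x) = \<zero>"
    "x \<in> carrier E \<Longrightarrow> q (r x) = \<zero>" "x \<in> carrier E \<Longrightarrow> r (q x) = \<zero>"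
  using assms endoD(1) unfolding split3_def by blast+

lemma split3_rotate:
  assumes "split3 p q r"
  shows "split3 q r p"
  unfolding split3_def
proof (intro conjI ballI)
  note D = split3D[OF assms]
  show "endo q" "endo r" "endo p" using D(1-3) by simp_all
  fix x assume x: "x \<in> carrier E"
  show "q x \<oplus> (r x \<oplus> p x) = x"
    using D(4-7)[OF x] by (metis M.a_assoc M.a_comm)
  show "q (r x) = \<zero>" "r (q x) = \<zero>" "q (p x) = \<zero>" "p (q x) = \<zero>" "r (p x) = \<zero>" "p (r x) = \<zero>"
    using D(8-13)[OF x] by simp_all
qed

lemma split3_splitting:
  assumes "split3 p q r"
  shows "splitting p (\<lambda>x. q x \<oplus> r x)"
proof -
  note D = split3D[OF assms]
  show ?thesis
    unfolding splitting_def
  proof (intro conjI ballI)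
    show "endo p" "endo (\<lambda>x. q x \<oplus> r x)" using D(1) endo_add[OF D(2,3)] .
  qed (simp_all add: D(4-13) endoD(2)[OF D(1)])
qed

text \<open>
  Only the diagonal blocks matter, as off-diagonal blocks have square zero.
\<close>

lemma split3_preserves:
  assumes M: "aut_invariant M" and pqr: "split3 p q r" and f: "endo f" and x: "x \<in> M"
    and "p (f (p x)) \<in> M" "q (f (q x)) \<in> M" "r (f (r x)) \<in> M"
  shows "f x \<in> M"
proof -
  have sM: "submod M" using M by (simp add: aut_invariant_def)
  note D = split3D[OF pqr]
  note fc = endoD(1)[OF f]
  note off = offdiagonal_preserves[OF M _ _ f _ x]
  have xc: "x \<in> carrier E" using x sM submodD(3) by blast
  have row: "s (f x) \<in> M"
    if s: "endo s" and "s (f (p x)) \<in> M" "s (f (q x)) \<in> M" "s (f (r x)) \<in> M" for s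
  proof -
    have "s (f x) = s (f (p x \<oplus> (q x \<oplus> r x)))" using D(7)[OF xc] by simp
    also have "\<dots> = s (f (p x)) \<oplus> (s (f (q x)) \<oplus> s (f (r x)))"
      using xc D(4-6) fc by (simp add: endoD(2)[OF f] endoD(2)[OF s])
    finally show ?thesis using that submodD(4)[OF sM] by simp
  qed
  have "p (f x) \<in> M" by (rule row[OF D(1) assms(5) off[OF D(1,2,9)] off[OF D(1,3,11)]])
  moreover have "q (f x) \<in> M" by (rule row[OF D(2) off[OF D(2,1,8)] assms(6) off[OF D(2,3,13)]])
  moreover have "r (f x) \<in> M" by (rule row[OF D(3) off[OF D(3,1,10)] off[OF D(3,2,12)] assms(7)])
  ultimately have "p (f x) \<oplus> (q (f x) \<oplus> r (f x)) \<in> M" using submodD(4)[OF sM] by blast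
  then show ?thesis using D(7) fc[OF xc] by simp
qed

text \<open>
  An envelope of a submodule of \<open>\<gamma> E\<close> can be chosen as a summand of \<open>\<gamma> E\<close>: take a splitting
  \<open>(p, q)\<close> for \<open>A\<close> with \<open>p\<close> vanishing on \<open>\<delta> E\<close>, and compress \<open>p\<close> and \<open>q\<close> to \<open>\<gamma> p\<close> and \<open>\<gamma> q\<close>.
\<close>

lemma refine_splitting:
  assumes gd: "splitting \<gamma> \<delta>" and A: "submod A" "A \<subseteq> rng \<gamma>"
  shows "\<exists>\<pi> \<sigma>. split3 \<pi> \<sigma> \<delta> \<and> ess_in A (rng \<pi>) \<and>
    (\<forall>x\<in>carrier E. \<gamma> (\<pi> x) = \<pi> x \<and> \<gamma> (\<sigma> x) = \<sigma> x)"
proof -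
  note D = splittingD[OF gd]
  note gr = splitting_rng[OF gd] and dr = splitting_rng[OF splitting_sym[OF gd]]
  have gg: "\<gamma> (\<gamma> x) = \<gamma> x" if "x \<in> carrier E" for x using splitting_idem[OF gd that] .
  have "x = \<zero>" if "x \<in> A" "x \<in> rng \<delta>" for x
  proof -
    have "\<gamma> x = x" using that A(2) gr(1) by blast
    moreover have "\<gamma> x = \<zero>" using that dr(2) by blast
    ultimately show ?thesis by simp
  qed
  then obtain p q where pq: "splitting p q" and ess: "ess_in A (rng p)"
    and pd: "\<forall>x\<in>rng \<delta>. p x = \<zero>"
    using exists_splitting[OF A(1) submod_rng[OF D(2)]] by blast
  note S = splittingD[OF pq]
  have pdx: "p (\<delta> x) = \<zero>" if "x \<in> carrier E" for x using that pd by (auto simp: rng_def)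
  have pg: "p (\<gamma> x) = p x" if x: "x \<in> carrier E" for x
  proof -
    have "p (\<gamma> x \<oplus> \<delta> x) = p (\<gamma> x)"
      using x D(3,4) S(3) pdx by (simp add: endoD(2)[OF S(1)])
    then show ?thesis using D(5)[OF x] by simp
  qed
  let ?\<pi> = "\<lambda>x. \<gamma> (p x)" and ?\<sigma> = "\<lambda>x. \<gamma> (q x)"
  have e: "endo ?\<pi>" "endo ?\<sigma>" using endo_comp[OF D(1) S(1)] endo_comp[OF D(1) S(2)] .
  have "split3 ?\<pi> ?\<sigma> \<delta>"
    unfolding split3_def
  proof (intro conjI ballI e D(2))
    fix x assume x: "x \<in> carrier E"
    have "\<gamma> (p x) \<oplus> (\<gamma> (q x) \<oplus> \<delta> x) = \<gamma> (p x \<oplus> q x) \<oplus> \<delta> x"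
      using x D(3,4) S(3,4) by (simp add: endoD(2)[OF D(1)] M.a_assoc)
    also have "\<dots> = x" using x S(5) D(5) by simp
    finally show "\<gamma> (p x) \<oplus> (\<gamma> (q x) \<oplus> \<delta> x) = x" .
    show "\<gamma> (p (\<gamma> (q x))) = \<zero>" using x S(4,6) pg endo_zero[OF D(1)] by simp
    show "\<gamma> (p (\<delta> x)) = \<zero>" using x pdx endo_zero[OF D(1)] by simp
    show "\<delta> (\<gamma> (p x)) = \<zero>" "\<delta> (\<gamma> (q x)) = \<zero>" using x S(3,4) D(7) by simp_all
    have "q (\<delta> x) = \<delta> x" using S(4,5)[of "\<delta> x"] pdx[OF x] D(4)[OF x] by simp
    then show "\<gamma> (q (\<delta> x)) = \<zero>" using D(6)[OF x] by simp
    define y where "y = \<gamma> (p x)"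
    have y: "y \<in> carrier E" "\<gamma> y = y" using x S(3) D(3) gg by (simp_all add: y_def)
    have "p y = p x" using pg x S(3) splitting_idem[OF pq x] by (simp add: y_def)
    then have "\<gamma> (p y) = y" by (simp add: y_def)
    then have "y = y \<oplus> \<gamma> (q y)"
      using endoD(2)[OF D(1), of "p y" "q y"] S(3,4,5)[OF y(1)] y(2) by simp
    then have "\<gamma> (q y) = \<zero>"
      using y(1) S(4) D(3) M.add.l_cancel_one by metis
    then show "\<gamma> (q (\<gamma> (p x))) = \<zero>" by (simp add: y_def)
  qed
  moreover have "ess_in A (rng ?\<pi>)"
    unfolding ess_in_def
  proof (intro conjI allI impI A(1) submod_rng[OF e(1)])
    show "A \<subseteq> rng ?\<pi>"
    proof
      fix a assume a: "a \<in> A"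
      then have "p a = a" "\<gamma> a = a" "a \<in> carrier E"
        using ess_inD(3)[OF ess] A(2) splitting_rng(1)[OF pq] gr(1) by blast+
      then show "a \<in> rng ?\<pi>" unfolding rng_def by (metis image_eqI)
    qed
  next
    fix L assume L: "submod L \<and> L \<subseteq> rng ?\<pi> \<and> A \<inter> L = {\<zero>}"
    let ?L = "rng p \<inter> {x \<in> carrier E. \<gamma> x \<in> L}"
    have "?L = {\<zero>}"
    proof (rule ess_inD(4)[OF ess])
      show "submod ?L" using submod_Int submod_rng[OF S(1)] submod_vimage[OF D(1)] L by blast
      fix a assume a: "a \<in> A" "a \<in> ?L"
      then have "\<gamma> a = a" using A(2) gr(1) by blast
      then show "a = \<zero>" using a L by auto
    qed blast
    have "y = \<zero>" if y: "y \<in> L" for y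
    proof -
      obtain z where z: "z \<in> carrier E" "y = \<gamma> (p z)" using y L by (auto simp: rng_def)
      then have "p z \<in> ?L" using y S(3) by (auto simp: rng_def)
      then have "p z = \<zero>" using \<open>?L = {\<zero>}\<close> by blast
      then show ?thesis using z endo_zero[OF D(1)] by simp
    qed
    then show "L = {\<zero>}" using submod_trivI L by blast
  qed
  ultimately show ?thesis
    using gg S(3,4) by (intro exI[of _ ?\<pi>] exI[of _ ?\<sigma>]) simp
qed

text \<open>
  No two independent nonzero submodules of \<open>P\<close> are isomorphic.  By injectivity, an isomorphism
  between submodules is the restriction of an endomorphism \<open>k\<close> of \<open>E\<close>.
\<close>

definition square_free :: "'e set \<Rightarrow> bool" where
  "square_free P \<longleftrightarrow> (\<forall>D k. submod D \<and> endo k \<and> D \<subseteq> P \<and> k ` D \<subseteq> P \<and>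
     (\<forall>x\<in>D. k x = \<zero> \<longrightarrow> x = \<zero>) \<and> D \<inter> k ` D = {\<zero>} \<longrightarrow> D = {\<zero>})"

lemma square_freeD:
  assumes "square_free P" "submod D" "endo k" "D \<subseteq> P" "k ` D \<subseteq> P"
    "\<And>x. x \<in> D \<Longrightarrow> k x = \<zero> \<Longrightarrow> x = \<zero>" "\<And>x. x \<in> D \<Longrightarrow> x \<in> k ` D \<Longrightarrow> x = \<zero>"
  shows "D = {\<zero>}"
proof -
  have "\<zero> \<in> D \<inter> k ` D" using submodD(2)[OF assms(2)] submodD(2)[OF submod_image[OF assms(3,2)]] by simp
  then have "D \<inter> k ` D = {\<zero>}" using assms(7) by blast
  then show ?thesis using assms unfolding square_free_def by blast
qed

text \<open>
  Let \<open>g = \<gamma> f \<gamma>\<close> and split \<open>\<gamma> E = \<pi> E \<oplus> \<sigma> E\<close> with the kernel of \<open>g\<close> on \<open>\<gamma> E\<close> essential in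
  \<open>\<pi> E\<close>.  The block \<open>\<pi> g \<pi>\<close> has essential kernel.  On \<open>\<sigma> E\<close> the map \<open>g\<close> is one-to-one, so the kernel \<open>D\<close> of
  \<open>\<sigma> g\<close> on \<open>\<sigma> E\<close> is isomorphic to \<open>g D \<subseteq> \<pi> E\<close>; these are independent, so \<open>D = 0\<close>.  Square-freeness
  once more turns the one-to-one block \<open>\<sigma> g \<sigma>\<close> into an automorphism of \<open>\<sigma> E\<close>.
\<close>

lemma square_free_block_preserves:
  assumes M: "aut_invariant M" "splitting_invariant M" and gd: "splitting \<gamma> \<delta>"
    and sf: "square_free (rng \<gamma>)" and f: "endo f" and x: "x \<in> M"
  shows "\<gamma> (f (\<gamma> x)) \<in> M"
proof -
  have sM: "submod M" using M by (simp add: aut_invariant_def)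
  note D = splittingD[OF gd]
  note gr = splitting_rng[OF gd]
  have gg: "\<gamma> (\<gamma> x) = \<gamma> x" if "x \<in> carrier E" for x using splitting_idem[OF gd that] .
  define g where "g = (\<lambda>x. \<gamma> (f (\<gamma> x)))"
  have g: "endo g" unfolding g_def by (rule endo_comp[OF D(1) endo_comp[OF f D(1)]])
  note gc = endoD(1)[OF g]
  have g\<gamma>: "g (\<gamma> x) = g x" and \<gamma>g: "\<gamma> (g x) = g x" if "x \<in> carrier E" for x
    using that gg D(3) endoD(1)[OF f] by (simp_all add: g_def)
  let ?A = "rng \<gamma> \<inter> {x \<in> carrier E. g x = \<zero>}"
  have A: "submod ?A" using submod_Int submod_rng[OF D(1)] submod_ker[OF g] by blast
  obtain \<pi> \<sigma> where ps: "split3 \<pi> \<sigma> \<delta>" and ess: "ess_in ?A (rng \<pi>)"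
    and \<gamma>p: "\<forall>x\<in>carrier E. \<gamma> (\<pi> x) = \<pi> x \<and> \<gamma> (\<sigma> x) = \<sigma> x"
    using refine_splitting[OF gd A] by blast
  note S = split3D[OF ps]
  note psp = split3_splitting[OF ps] and sps = split3_splitting[OF split3_rotate[OF ps]]
  have r\<sigma>: "rng \<sigma> \<subseteq> rng \<gamma>" "rng \<pi> \<subseteq> rng \<gamma>"
    using \<gamma>p gr(1) S(4,5) by (auto simp: rng_def)
  have xc: "x \<in> carrier E" using x sM submodD(3) by blast
  have "g x \<in> M"
  proof (rule split3_preserves[OF M(1) ps g x])
    let ?j = "\<lambda>x. \<pi> (g (\<pi> x))"
    have j: "endo ?j" by (rule endo_comp[OF S(1) endo_comp[OF g S(1)]])
    show "?j x \<in> M"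
    proof (rule essential_kernel_preserves[OF M(1) j _ x])
      fix K assume K: "submod K" and inj: "\<And>x. x \<in> K \<Longrightarrow> ?j x = \<zero> \<Longrightarrow> x = \<zero>"
      show "K = {\<zero>}"
      proof (rule kernel_essential[OF psp ess j _ _ K inj])
        fix a assume a: "a \<in> ?A"
        then have "\<pi> a = a" using ess_inD(3)[OF ess] splitting_rng(1)[OF psp] by blast
        then show "?j a = \<zero>" using a endo_zero[OF S(1)] by simp
      next
        fix a assume a: "a \<in> carrier E"
        then show "?j (\<pi> a) = ?j a" using splitting_idem[OF psp a] by simp
      qed
    qed
    have "\<delta> (g (\<delta> x)) = \<zero>" using g\<gamma>[of "\<delta> x"] D(4,6) xc endo_zero[OF g] endo_zero[OF D(2)] by simp
    then show "\<delta> (g (\<delta> x)) \<in> M" using submodD(2)[OF sM] by simp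
    let ?h = "\<lambda>x. \<sigma> (g x)"
    have h: "endo ?h" by (rule endo_comp[OF S(2) g])
    have ginj: "z = \<zero>" if z: "z \<in> rng \<sigma>" "g z = \<zero>" for z
    proof -
      have "z \<in> ?A" using z r\<sigma> gr(1) by blast
      then have "\<pi> z = z" using ess_inD(3)[OF ess] splitting_rng(1)[OF psp] by blast
      moreover have "\<pi> z = \<zero>" using z(1) S(8) by (auto simp: rng_def)
      ultimately show ?thesis by simp
    qed
    have grng: "g z \<in> rng \<gamma>" if "z \<in> carrier E" for z
      using \<gamma>g[OF that] gc[OF that] gr(1) by blast
    show "\<sigma> (g (\<sigma> x)) \<in> M"
    proof (rule block_preserves[OF M sps h _ _ _ x])
      show "?h z \<in> rng \<sigma>" if "z \<in> rng \<sigma>" for z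
        using that gc S(5) by (auto simp: rng_def)
      show "z = \<zero>" if z: "z \<in> rng \<sigma>" "?h z = \<zero>" for z
      proof -
        let ?D = "rng \<sigma> \<inter> {x \<in> carrier E. ?h x = \<zero>}"
        have sD: "submod ?D" using submod_Int submod_rng[OF S(2)] submod_ker[OF h] by blast
        have "?D = {\<zero>}"
        proof (rule square_freeD[OF sf sD g])
          show "?D \<subseteq> rng \<gamma>" using r\<sigma> by blast
          show "g ` ?D \<subseteq> rng \<gamma>" using grng by blast
          show "w = \<zero>" if "w \<in> ?D" "g w = \<zero>" for w using ginj that by blast
          show "w = \<zero>" if w: "w \<in> ?D" "w \<in> g ` ?D" for w
          proof -
            obtain v where v: "v \<in> ?D" "w = g v" using w(2) by blast
            have wc: "w \<in> carrier E" using w by blast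
            have "\<sigma> w = w" using w(1) splitting_rng(1)[OF sps] by blast
            moreover have "\<sigma> w = \<zero>" using v by blast
            ultimately show ?thesis by simp
          qed
        qed
        then show ?thesis using z submodD(3)[OF submod_rng[OF S(2)]] by blast
      qed
      show "C = {\<zero>}" if C: "submod C" "C \<subseteq> rng \<sigma>" "C \<inter> ?h ` C = {\<zero>}" for C
      proof (rule square_freeD[OF sf C(1) h])
        have c: "z \<in> carrier E" if "z \<in> C" for z using that C(1) submodD(3) by blast
        show "C \<subseteq> rng \<gamma>" using C(2) r\<sigma> by blast
        show "?h ` C \<subseteq> rng \<gamma>" using r\<sigma>(1) c gc by (auto simp: rng_def)
        show "z = \<zero>" if "z \<in> C" "?h z = \<zero>" for z using \<open>\<And>z. z \<in> rng \<sigma> \<Longrightarrow> ?h z = \<zero> \<Longrightarrow> z = \<zero>\<close> that C(2) by blast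
        show "z = \<zero>" if "z \<in> C" "z \<in> ?h ` C" for z using that C(3) by blast
      qed
    qed
  qed
  then show ?thesis by (simp add: g_def)
qed

text \<open>
  Graphs of isomorphisms between two independent submodules, the domain and the range of \<open>G\<close>.
\<close>

definition square_rel :: "('e \<times> 'e) set \<Rightarrow> bool" where
  "square_rel G \<longleftrightarrow> linear_relation G \<and> (\<forall>x y. (x, y) \<in> G \<longrightarrow> (x = \<zero> \<longleftrightarrow> y = \<zero>)) \<and>
     (\<forall>x y z. (x, y) \<in> G \<and> (z, x) \<in> G \<longrightarrow> x = \<zero>)"

lemma linear_relation_converse: "linear_relation G \<Longrightarrow> linear_relation (G\<inverse>)"
  unfolding linear_relation_def by auto

lemma submod_Domain: "linear_relation G \<Longrightarrow> submod (Domain G)"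
  by (rule submodI) (auto simp: linear_relation_def, blast+)

lemma submod_Range: "linear_relation G \<Longrightarrow> submod (Range G)"
  using submod_Domain[OF linear_relation_converse] by simp

lemma linear_relationD:
  assumes "linear_relation G"
  shows "(x, y) \<in> G \<Longrightarrow> x \<in> carrier E" "(x, y) \<in> G \<Longrightarrow> y \<in> carrier E" "(\<zero>, \<zero>) \<in> G"
    "(x, y) \<in> G \<Longrightarrow> (x', y') \<in> G \<Longrightarrow> (x \<oplus> x', y \<oplus> y') \<in> G"
    "(x, y) \<in> G \<Longrightarrow> a \<in> carrier R \<Longrightarrow> (x \<star> a, y \<star> a) \<in> G"
  using assms unfolding linear_relation_def by auto

lemma linear_relation_chain_Union:
  assumes ne: "Cs \<noteq> {}" and lin: "\<And>A. A \<in> Cs \<Longrightarrow> linear_relation A"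
    and tot: "\<And>A B. A \<in> Cs \<Longrightarrow> B \<in> Cs \<Longrightarrow> A \<subseteq> B \<or> B \<subseteq> A"
  shows "linear_relation (\<Union>Cs)"
  unfolding linear_relation_def
proof (intro conjI allI impI ballI)
  show "\<Union>Cs \<subseteq> carrier E \<times> carrier E" using linear_relationD(1,2)[OF lin] by auto
  show "(\<zero>, \<zero>) \<in> \<Union>Cs" using ne linear_relationD(3)[OF lin] by blast
next
  fix x y x' y' assume "(x, y) \<in> \<Union>Cs \<and> (x', y') \<in> \<Union>Cs"
  then obtain A B where AB: "A \<in> Cs" "B \<in> Cs" "(x, y) \<in> A" "(x', y') \<in> B" by blast
  then obtain L where "L \<in> Cs" "(x, y) \<in> L" "(x', y') \<in> L" using tot by blast
  then show "(x \<oplus> x', y \<oplus> y') \<in> \<Union>Cs" using linear_relationD(4)[OF lin] by blast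
next
  fix x y a assume "a \<in> carrier R" "(x, y) \<in> \<Union>Cs"
  then show "(x \<star> a, y \<star> a) \<in> \<Union>Cs" using linear_relationD(5)[OF lin] by blast
qed

lemma maximal_square_rel:
  "\<exists>G. square_rel G \<and> (\<forall>H. square_rel H \<longrightarrow> G \<subseteq> H \<longrightarrow> H = G)"
proof -
  have "\<exists>G\<in>Collect square_rel. \<forall>H\<in>Collect square_rel. G \<subseteq> H \<longrightarrow> H = G"
  proof (rule subset_Zorn_nonempty)
    have "square_rel {(\<zero>, \<zero>)}" by (simp add: square_rel_def linear_relation_def zero_ract)
    then show "Collect square_rel \<noteq> {}" by blast
    fix Cs assume ne: "Cs \<noteq> {}" and ch: "subset.chain (Collect square_rel) Cs"
    then have sq: "\<And>A. A \<in> Cs \<Longrightarrow> square_rel A"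
      and tot: "\<And>A B. A \<in> Cs \<Longrightarrow> B \<in> Cs \<Longrightarrow> A \<subseteq> B \<or> B \<subseteq> A"
      by (auto simp: subset_chain_def)
    have "linear_relation (\<Union>Cs)"
      by (rule linear_relation_chain_Union[OF ne _ tot]) (use sq in \<open>auto simp: square_rel_def\<close>)
    moreover have "x = \<zero> \<longleftrightarrow> y = \<zero>" if xy: "(x, y) \<in> \<Union>Cs" for x y
    proof -
      from xy obtain A where "A \<in> Cs" "(x, y) \<in> A" by blast
      then show ?thesis using sq unfolding square_rel_def by blast
    qed
    moreover have "x = \<zero>" if xyz: "(x, y) \<in> \<Union>Cs" "(z, x) \<in> \<Union>Cs" for x y z
    proof -
      from xyz obtain A B where AB: "A \<in> Cs" "B \<in> Cs" "(x, y) \<in> A" "(z, x) \<in> B" by blast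
      then obtain L where "L \<in> Cs" "(x, y) \<in> L" "(z, x) \<in> L" using tot by blast
      then show ?thesis using sq unfolding square_rel_def by blast
    qed
    ultimately show "\<Union>Cs \<in> Collect square_rel" unfolding square_rel_def by blast
  qed
  then show ?thesis by blast
qed

text \<open>
  If \<open>v\<close> inverts \<open>q u\<close> on \<open>A\<close>, then \<open>p\<close> agrees with the
  composite \<open>s\<close> of \<open>q u p : pE \<rightarrow> qE\<close> and \<open>p v q : qE \<rightarrow> pE\<close> on the essential submodule \<open>A \<oplus> p'E\<close>.
  So \<open>p f p\<close> equals \<open>p f s\<close>, a product of two off-diagonal maps, up to a map with essential
  kernel.
\<close>

lemma transported_block_preserves:
  assumes M: "aut_invariant M" and pp: "splitting p p'" and A: "ess_in A (rng p)"
    and q: "endo q" and pq: "\<And>x. x \<in> carrier E \<Longrightarrow> p (q x) = \<zero>"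
    and qp: "\<And>x. x \<in> carrier E \<Longrightarrow> q (p x) = \<zero>"
    and qq: "\<And>x. x \<in> carrier E \<Longrightarrow> q (q x) = q x"
    and u: "endo u" and v: "endo v" and vu: "\<And>x. x \<in> A \<Longrightarrow> v (q (u x)) = x"
    and f: "endo f" and x: "x \<in> M"
  shows "p (f (p x)) \<in> M"
proof -
  have sM: "submod M" using M by (simp add: aut_invariant_def)
  note p = splittingD(1)[OF pp]
  note c = endoD(1)[OF p] endoD(1)[OF q] endoD(1)[OF u] endoD(1)[OF v] endoD(1)[OF f]
  have ppx: "p (p x) = p x" if "x \<in> carrier E" for x using splitting_idem[OF pp that] .
  have xc: "x \<in> carrier E" using x sM submodD(3) by blast
  have Ac: "a \<in> carrier E" "p a = a" if "a \<in> A" for a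
    using that ess_inD(3)[OF A] splitting_rng(1)[OF pp] by blast+
  define s where "s = (\<lambda>x. p (v (q (u (p x)))))"
  have s: "endo s"
    unfolding s_def by (rule endo_comp[OF p endo_comp[OF v endo_comp[OF q endo_comp[OF u p]]]])
  note sc = endoD(1)[OF s]
  define j where "j = (\<lambda>x. p (f (p x \<ominus> s x)))"
  have j: "endo j"
    unfolding j_def by (rule endo_comp[OF p endo_comp[OF f endo_subtract[OF p s]]])
  have "j x \<in> M"
  proof (rule essential_kernel_preserves[OF M j _ x])
    fix K assume K: "submod K" and inj: "\<And>x. x \<in> K \<Longrightarrow> j x = \<zero> \<Longrightarrow> x = \<zero>"
    show "K = {\<zero>}"
    proof (rule kernel_essential[OF pp A j _ _ K inj])
      fix a assume a: "a \<in> A"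
      then have "s a = a" using vu Ac by (simp add: s_def)
      then show "j a = \<zero>" using Ac[OF a] endo_zero[OF p] endo_zero[OF f] by (simp add: j_def diff_self)
    next
      fix a assume "a \<in> carrier E"
      then show "j (p a) = j a" by (simp add: j_def s_def ppx)
    qed
  qed
  moreover have "p (f (s x)) \<in> M"
  proof -
    let ?z = "q (u (p x))"
    have z: "?z \<in> M" by (rule offdiagonal_preserves[OF M q p u pq x])
    have "p (f (p (v (q ?z)))) \<in> M"
      by (rule offdiagonal_preserves[OF M p q endo_comp[OF f endo_comp[OF p v]] qp z])
    then show ?thesis using qq xc c by (simp add: s_def)
  qed
  moreover have "p (f (p x)) = j x \<oplus> p (f (s x))"
  proof -
    have "p x \<ominus> s x \<oplus> s x = p x"
      using xc c(1) sc by (simp add: a_minus_def M.a_assoc M.l_neg)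
    moreover have "j x \<oplus> p (f (s x)) = p (f (p x \<ominus> s x \<oplus> s x))"
      using xc c sc by (simp add: j_def endoD(2)[OF p] endoD(2)[OF f])
    ultimately show ?thesis by simp
  qed
  ultimately show ?thesis using submodD(4)[OF sM] by simp
qed

text \<open>
  Blocks over \<open>E(X)\<close> and \<open>E(Y)\<close> are dealt with by the maximal isomorphism \<open>X \<rightarrow> Y\<close>.  The remaining
  summand \<open>rE\<close> is square-free, since an isomorphism \<open>k\<close> between independent submodules of \<open>rE\<close>
  could be added to the maximal one.
\<close>

theorem endo_invariant:
  assumes M: "aut_invariant M" "splitting_invariant M" and f: "endo f" and x: "x \<in> M"
  shows "f x \<in> M"
proof -
  have sM: "submod M" using M by (simp add: aut_invariant_def)
  obtain G where G: "square_rel G" and Gmax: "\<And>H. square_rel H \<Longrightarrow> G \<subseteq> H \<Longrightarrow> H = G"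
    using maximal_square_rel by blast
  have lin: "linear_relation G" and z: "\<And>x y. (x, y) \<in> G \<Longrightarrow> x = \<zero> \<longleftrightarrow> y = \<zero>"
    and dis: "\<And>x y z. (x, y) \<in> G \<Longrightarrow> (z, x) \<in> G \<Longrightarrow> x = \<zero>"
    using G unfolding square_rel_def by blast+
  note L = linear_relationD[OF lin]
  let ?X = "Domain G" and ?Y = "Range G"
  note sX = submod_Domain[OF lin] and sY = submod_Range[OF lin]
  have "a = \<zero>" if "a \<in> ?X" "a \<in> ?Y" for a using that dis by blast
  then obtain p p' where pp: "splitting p p'" and eX: "ess_in ?X (rng p)"
    and pY: "\<forall>y\<in>?Y. p y = \<zero>"
    using exists_splitting[OF sX sY] by blast
  note pp' = splitting_sym[OF pp]
  have "?Y \<subseteq> rng p'" using pY splitting_rng(2)[OF pp'] submodD(1)[OF sY] by blast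
  then obtain q r where qrp: "split3 q r p" and eY: "ess_in ?Y (rng q)"
    using refine_splitting[OF pp' sY] by blast
  note S = split3D[OF qrp]
  note sq = split3_splitting[OF qrp] and sr = split3_splitting[OF split3_rotate[OF qrp]]
  have Xp: "p a = a" "q a = \<zero>" "r a = \<zero>" if "a \<in> ?X" for a
  proof -
    have a: "a \<in> carrier E" "p a = a"
      using that ess_inD(3)[OF eX] splitting_rng(1)[OF pp] by blast+
    then show "p a = a" "q a = \<zero>" "r a = \<zero>" using S(10)[OF a(1)] S(12)[OF a(1)] by simp_all
  qed
  have Yq: "q a = a" "p a = \<zero>" "r a = \<zero>" if "a \<in> ?Y" for a
  proof -
    have a: "a \<in> carrier E" "q a = a"
      using that ess_inD(3)[OF eY] splitting_rng(1)[OF sq] by blast+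
    then show "q a = a" "p a = \<zero>" "r a = \<zero>" using S(9)[OF a(1)] S(11)[OF a(1)] by simp_all
  qed
  have R0: "r a = a" "p a = \<zero>" "q a = \<zero>" "a \<in> carrier E" if "a \<in> rng r" for a
  proof -
    show a: "a \<in> carrier E" "r a = a" using that splitting_rng(1)[OF sr] by blast+
    then show "p a = \<zero>" "q a = \<zero>" using S(13)[OF a(1)] S(8)[OF a(1)] by simp_all
  qed
  have sf: "square_free (rng r)"
    unfolding square_free_def
  proof (intro allI impI, elim conjE)
    fix D k assume D: "submod D" "D \<subseteq> rng r" and k: "endo k" "k ` D \<subseteq> rng r"
      "\<forall>x\<in>D. k x = \<zero> \<longrightarrow> x = \<zero>" "D \<inter> k ` D = {\<zero>}"
    \<comment> \<open>the graph of the sum of the maximal isomorphism and \<open>k\<close>\<close>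
    define H where "H = {(x \<oplus> d, y \<oplus> k d) | x y d. (x, y) \<in> G \<and> d \<in> D}"
    note kc = endoD(1)[OF k(1)]
    have dr: "d \<in> rng r" "k d \<in> rng r" if "d \<in> D" for d using that D(2) k(2) by blast+
    have HI: "(x \<oplus> d, y \<oplus> k d) \<in> H" if "(x, y) \<in> G" "d \<in> D" for x y d
      using that by (auto simp: H_def)
    have sel: "p (x \<oplus> d) = x" "q (x \<oplus> d) = \<zero>" "r (x \<oplus> d) = d"
      "p (y \<oplus> k d) = \<zero>" "q (y \<oplus> k d) = y" "r (y \<oplus> k d) = k d"
      if xyd: "(x, y) \<in> G" "d \<in> D" for x y d
    proof -
      have X: "x \<in> ?X" and Y: "y \<in> ?Y" using xyd by blast+
      note e = endoD(2)[OF S(1)] endoD(2)[OF S(2)] endoD(2)[OF S(3)]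
      show "p (x \<oplus> d) = x" "q (x \<oplus> d) = \<zero>" "r (x \<oplus> d) = d"
        "p (y \<oplus> k d) = \<zero>" "q (y \<oplus> k d) = y" "r (y \<oplus> k d) = k d"
        using Xp[OF X] Yq[OF Y] R0[OF dr(1)[OF xyd(2)]] R0[OF dr(2)[OF xyd(2)]] L(1,2)[OF xyd(1)]
        by (simp_all add: e)
    qed
    have linH: "linear_relation H"
      unfolding linear_relation_def
    proof (intro conjI allI impI ballI)
      show "H \<subseteq> carrier E \<times> carrier E"
        using L(1,2) R0(4) dr by (auto simp: H_def)
      show "(\<zero>, \<zero>) \<in> H"
        using HI[OF L(3) submodD(2)[OF D(1)]] endo_zero[OF k(1)] by simp
    next
      fix s t s' t' assume "(s, t) \<in> H \<and> (s', t') \<in> H"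
      then obtain x y d x' y' d' where *: "s = x \<oplus> d" "t = y \<oplus> k d" "(x, y) \<in> G" "d \<in> D"
        "s' = x' \<oplus> d'" "t' = y' \<oplus> k d'" "(x', y') \<in> G" "d' \<in> D" unfolding H_def by blast
      note cs = L(1,2)[OF *(3)] L(1,2)[OF *(7)] R0(4)[OF dr(1)[OF *(4)]] R0(4)[OF dr(1)[OF *(8)]]
        R0(4)[OF dr(2)[OF *(4)]] R0(4)[OF dr(2)[OF *(8)]]
      have "s \<oplus> s' = (x \<oplus> x') \<oplus> (d \<oplus> d')" "t \<oplus> t' = (y \<oplus> y') \<oplus> k (d \<oplus> d')"
        using * cs by (simp_all add: endoD(2)[OF k(1)] M.a_ac)
      then show "(s \<oplus> s', t \<oplus> t') \<in> H"
        using HI[OF L(4)[OF *(3,7)] submodD(4)[OF D(1) *(4,8)]] by simp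
    next
      fix s t a assume a: "a \<in> carrier R" and "(s, t) \<in> H"
      then obtain x y d where *: "s = x \<oplus> d" "t = y \<oplus> k d" "(x, y) \<in> G" "d \<in> D"
        unfolding H_def by blast
      note cs = L(1,2)[OF *(3)] R0(4)[OF dr(1)[OF *(4)]] R0(4)[OF dr(2)[OF *(4)]]
      have "s \<star> a = x \<star> a \<oplus> d \<star> a" "t \<star> a = y \<star> a \<oplus> k (d \<star> a)"
        using * cs a by (simp_all add: endoD(3)[OF k(1)] ract_add)
      then show "(s \<star> a, t \<star> a) \<in> H"
        using HI[OF L(5)[OF *(3) a] submodD(5)[OF D(1) *(4) a]] by simp
    qed
    have "square_rel H"
      unfolding square_rel_def
    proof (intro conjI allI impI linH)
      fix s t assume "(s, t) \<in> H"
      then obtain x y d where *: "s = x \<oplus> d" "t = y \<oplus> k d" "(x, y) \<in> G" "d \<in> D"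
        unfolding H_def by blast
      note s = sel[OF *(3,4)]
      show "s = \<zero> \<longleftrightarrow> t = \<zero>"
      proof
        assume "s = \<zero>"
        then have "x = \<zero>" "d = \<zero>"
          using s(1,3) *(1) endo_zero[OF S(3)] endo_zero[OF S(2)] by simp_all
        then show "t = \<zero>" using z[OF *(3)] *(2) endo_zero[OF k(1)] by simp
      next
        assume "t = \<zero>"
        then have "y = \<zero>" "k d = \<zero>"
          using s(5,6) *(2) endo_zero[OF S(1)] endo_zero[OF S(2)] by simp_all
        then have "x = \<zero>" "d = \<zero>" using z[OF *(3)] k(3) *(4) by simp_all
        then show "s = \<zero>" using *(1) by simp
      qed
    next
      fix s t w assume "(s, t) \<in> H \<and> (w, s) \<in> H"
      then obtain x y d x' y' d' where *: "s = x \<oplus> d" "(x, y) \<in> G" "d \<in> D"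
        "s = y' \<oplus> k d'" "(x', y') \<in> G" "d' \<in> D" unfolding H_def by blast
      note s = sel[OF *(2,3)] sel[OF *(5,6)]
      have "x = \<zero>" using s(1,10) *(1,4) by simp
      moreover have "d = k d'" using s(3,12) *(1,4) by simp
      then have "d \<in> D \<inter> k ` D" using *(3,6) by blast
      then have "d = \<zero>" using k(4) by blast
      ultimately show "s = \<zero>" using *(1) by simp
    qed
    moreover have "G \<subseteq> H"
    proof (rule subrelI)
      fix x y assume xy: "(x, y) \<in> G"
      then show "(x, y) \<in> H"
        using HI[OF xy submodD(2)[OF D(1)]] L(1,2)[OF xy] endo_zero[OF k(1)] by simp
    qed
    ultimately have HG: "H = G" using Gmax by blast
    have "d = \<zero>" if d: "d \<in> D" for d
    proof -
      have "\<zero> \<oplus> d \<in> ?X" using HI[OF L(3) d] HG by blast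
      then have "d \<in> ?X" using R0(4)[OF dr(1)[OF d]] by simp
      then show ?thesis using Xp(3) R0(1)[OF dr(1)[OF d]] by simp
    qed
    then show "D = {\<zero>}" using submod_trivI D(1) by blast
  qed
  obtain u where u: "endo u" "\<And>x y. (x, y) \<in> G \<Longrightarrow> u x = y"
    using linear_relation_extends[OF lin] z by blast
  obtain v where v: "endo v" "\<And>x y. (x, y) \<in> G \<Longrightarrow> v y = x"
    using linear_relation_extends[OF linear_relation_converse[OF lin]] z by blast
  show ?thesis
  proof (rule split3_preserves[OF M(1) qrp f x])
    show "p (f (p x)) \<in> M"
    proof (rule transported_block_preserves[OF M(1) pp eX S(1) S(11) S(10) splitting_idem[OF sq] u(1) v(1) _ f x])
      fix a assume "a \<in> ?X"
      then obtain b where ab: "(a, b) \<in> G" by blast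
      then have "q b = b" using Yq by blast
      then show "v (q (u a)) = a" using u(2)[OF ab] v(2)[OF ab] by simp
    qed
    show "q (f (q x)) \<in> M"
    proof (rule transported_block_preserves[OF M(1) sq eY S(3) S(10) S(11) splitting_idem[OF pp] v(1) u(1) _ f x])
      fix b assume "b \<in> ?Y"
      then obtain a where ab: "(a, b) \<in> G" by blast
      then have "p a = a" using Xp by blast
      then show "u (p (v b)) = b" using u(2)[OF ab] v(2)[OF ab] by simp
    qed
    show "r (f (r x)) \<in> M" by (rule square_free_block_preserves[OF M sr sf f x])
  qed
qed

section \<open>Essential submodules adapted to a splitting\<close>

text \<open>
  Let \<open>K\<close> meet \<open>A + B\<close> trivially.  If \<open>x \<in> K \<inter> M\<close> has \<open>p x \<in> A\<close>, then \<open>x = p x + q x\<close> lies in \<open>A + B\<close>, so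
  \<open>x = 0\<close>.  Thus \<open>p (K \<inter> M)\<close> meets \<open>A\<close> trivially and vanishes, and the same argument shows that
  \<open>K \<inter> M\<close> vanishes.
\<close>

lemma sum_essential:
  assumes M: "ess_in M (carrier E)" and pq: "splitting p q"
    and A: "ess_in A (rng p)" and B: "submod B" "q ` M \<subseteq> B"
  shows "ess_in {a \<oplus> b | a b. a \<in> A \<and> b \<in> B} (carrier E)" (is "ess_in ?S _")
proof -
  note S = splittingD[OF pq]
  note sA = ess_inD(1)[OF A] and sM = ess_inD(1)[OF M]
  have sS: "submod ?S" by (rule submod_set_sum[OF sA B(1)])
  have inS: "a \<oplus> b \<in> ?S" if "a \<in> A" "b \<in> B" for a b using that by blast
  have BS: "b \<in> ?S" if "b \<in> B" for b
    using inS[OF submodD(2)[OF sA] that] submodD(3)[OF B(1) that] by simp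
  show ?thesis
    unfolding ess_in_def
  proof (intro conjI allI impI sS submod_carrier submodD(1)[OF sS])
    fix K assume K: "submod K \<and> K \<subseteq> carrier E \<and> ?S \<inter> K = {\<zero>}"
    then have SK: "x = \<zero>" if "x \<in> ?S" "x \<in> K" for x using that by blast
    let ?K = "K \<inter> M"
    have sK: "submod ?K" using submod_Int K sM by blast
    note kc = submodD(3)[OF sK]
    have x: "q x \<in> B" if "x \<in> ?K" for x using B(2) that by blast
    have "p ` ?K = {\<zero>}"
    proof (rule ess_inD(4)[OF A submod_image[OF S(1) sK]])
      show "p ` ?K \<subseteq> rng p" using kc by (auto simp: rng_def)
      fix y assume y: "y \<in> A" "y \<in> p ` ?K"
      then obtain x where xK: "x \<in> ?K" "y = p x" by blast
      then have "p x \<oplus> q x \<in> ?S" using inS y(1) x by blast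
      then have "x \<in> ?S" using S(5)[OF kc[OF xK(1)]] by simp
      then have "x = \<zero>" using SK xK(1) by blast
      then show "y = \<zero>" using xK(2) endo_zero[OF S(1)] by simp
    qed
    then have "x = \<zero>" if "x \<in> ?K" for x
    proof -
      have "p x = \<zero>" using \<open>p ` ?K = {\<zero>}\<close> that by blast
      then have "q x = x" using S(4,5)[OF kc[OF that]] by simp
      then have "x \<in> ?S" using BS[OF x[OF that]] by simp
      then show ?thesis using SK that by blast
    qed
    then have K0: "x = \<zero>" if "x \<in> M" "x \<in> K" for x using that by blast
    show "K = {\<zero>}" by (rule ess_inD(4)[OF M _ _ K0]) (use K in blast)+
  qed
qed

end

section \<open>Uniqueness of injective envelopes\<close>

lemma rmod_homD:
  assumes "f \<in> rmod_hom R M N"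
  shows "x \<in> carrier M \<Longrightarrow> f x \<in> carrier N"
    "x \<in> carrier M \<Longrightarrow> y \<in> carrier M \<Longrightarrow> f (x \<oplus>\<^bsub>M\<^esub> y) = f x \<oplus>\<^bsub>N\<^esub> f y"
    "x \<in> carrier M \<Longrightarrow> a \<in> carrier R \<Longrightarrow> f (x \<star>\<^bsub>M\<^esub> a) = f x \<star>\<^bsub>N\<^esub> a"
  using assms by (auto simp: rmod_hom_def)

lemma rmod_hom_zero:
  assumes "right_module R M" "right_module R N" "f \<in> rmod_hom R M N"
  shows "f \<zero>\<^bsub>M\<^esub> = \<zero>\<^bsub>N\<^esub>"
proof -
  interpret M: right_module R M by fact
  interpret N: right_module R N by fact
  have "f (\<zero>\<^bsub>M\<^esub> \<star>\<^bsub>M\<^esub> \<zero>\<^bsub>R\<^esub>) = f \<zero>\<^bsub>M\<^esub> \<star>\<^bsub>N\<^esub> \<zero>\<^bsub>R\<^esub>"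
    by (rule rmod_homD(3)[OF assms(3)]) auto
  then show ?thesis
    using rmod_homD(1)[OF assms(3)] by (simp add: M.ract_zero_scalar N.ract_zero_scalar)
qed

lemma rmod_hom_minus:
  assumes "right_module R M" "right_module R N" "f \<in> rmod_hom R M N" "x \<in> carrier M"
  shows "f (\<ominus>\<^bsub>M\<^esub> x) = \<ominus>\<^bsub>N\<^esub> f x"
proof -
  interpret M: right_module R M by fact
  interpret N: right_module R N by fact
  have "f (x \<star>\<^bsub>M\<^esub> (\<ominus>\<^bsub>R\<^esub> \<one>\<^bsub>R\<^esub>)) = f x \<star>\<^bsub>N\<^esub> (\<ominus>\<^bsub>R\<^esub> \<one>\<^bsub>R\<^esub>)"
    by (rule rmod_homD(3)[OF assms(3,4)]) auto
  then show ?thesis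
    using rmod_homD(1)[OF assms(3,4)] assms(4) by (simp add: M.ract_minus_one N.ract_minus_one)
qed

lemma rsubmodule_kernel:
  assumes M: "right_module R M" and N: "right_module R N" and f: "f \<in> rmod_hom R M N"
  shows "rsubmodule R {x \<in> carrier M. f x = \<zero>\<^bsub>N\<^esub>} M"
proof -
  interpret M: right_module R M by fact
  interpret N: right_module R N by fact
  have "\<zero>\<^bsub>N\<^esub> \<star>\<^bsub>N\<^esub> a = \<zero>\<^bsub>N\<^esub>" if "a \<in> carrier R" for a
    using that N.ract_add[of "\<zero>\<^bsub>N\<^esub>" "\<zero>\<^bsub>N\<^esub>" a] by (simp add: N.M.add.l_cancel_one)
  then show ?thesis
    using rmod_hom_zero[OF M N f] by (auto simp: M.rsubmodule_iff rmod_homD[OF f])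
qed

lemma rmod_hom_injI:
  assumes M: "right_module R M" and N: "right_module R N" and f: "f \<in> rmod_hom R M N"
    and ker: "\<And>x. x \<in> carrier M \<Longrightarrow> f x = \<zero>\<^bsub>N\<^esub> \<Longrightarrow> x = \<zero>\<^bsub>M\<^esub>"
  shows "inj_on f (carrier M)"
proof (rule inj_onI)
  interpret M: right_module R M by fact
  interpret N: right_module R N by fact
  fix x y assume xy: "x \<in> carrier M" "y \<in> carrier M" "f x = f y"
  have "f (x \<oplus>\<^bsub>M\<^esub> \<ominus>\<^bsub>M\<^esub> y) = \<zero>\<^bsub>N\<^esub>"
    using xy rmod_homD[OF f] by (simp add: rmod_hom_minus[OF M N f] N.M.r_neg)
  then have "x \<oplus>\<^bsub>M\<^esub> \<ominus>\<^bsub>M\<^esub> y = \<zero>\<^bsub>M\<^esub>" using ker xy by simp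
  then show "x = y" using xy M.M.minus_equality[of x "\<ominus>\<^bsub>M\<^esub> y"] by simp
qed

text \<open>
  The isomorphism \<open>\<iota> M \<rightarrow> \<iota>' M\<close> extends to a map \<open>h : E \<rightarrow> E'\<close>, which is one-to-one as \<open>\<iota> M\<close> is
  essential.  A left inverse \<open>k\<close> of \<open>h\<close> exists because \<open>E\<close> is injective, and it is one-to-one because
  \<open>\<iota>' M\<close> is essential, so \<open>h\<close> and \<open>k\<close> are mutually inverse.
\<close>

lemma envelope_unique:
  fixes E E' :: "('a, 'e) right_module"
  assumes M: "right_module R M" and env: "injective_envelope R M E \<iota>" "injective_envelope R M E' \<iota>'"
  shows "\<exists>\<phi>\<in>rmod_hom R E E'. bij_betw \<phi> (carrier E) (carrier E') \<and>
    (\<forall>x\<in>carrier M. \<phi> (\<iota> x) = \<iota>' x)"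
proof -
  note e = env(1)[unfolded injective_envelope_def] and e' = env(2)[unfolded injective_envelope_def]
  have E: "right_module R E" and E': "right_module R E'" using e e' by blast+
  interpret M: right_module R M by fact
  interpret E: right_module R E by fact
  interpret E': right_module R E' by fact
  have i: "\<iota> \<in> rmod_hom R M E" "inj_on \<iota> (carrier M)" and i': "\<iota>' \<in> rmod_hom R M E'" "inj_on \<iota>' (carrier M)"
    using e e' by blast+
  note I = rmod_homD[OF i(1)] and I' = rmod_homD[OF i'(1)]
  let ?A = "E\<lparr>carrier := \<iota> ` carrier M\<rparr>"
  have sA: "rsubmodule R (\<iota> ` carrier M) E" "rsubmodule R (\<iota>' ` carrier M) E'"
    using e e' by (auto simp: essential_submodule_def)
  have essE: "K = {\<zero>\<^bsub>E\<^esub>}" if "rsubmodule R K E" "\<iota> ` carrier M \<inter> K = {\<zero>\<^bsub>E\<^esub>}" for K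
    using e that by (auto simp: essential_submodule_def)
  have essE': "K = {\<zero>\<^bsub>E'\<^esub>}" if "rsubmodule R K E'" "\<iota>' ` carrier M \<inter> K = {\<zero>\<^bsub>E'\<^esub>}" for K
    using e' that by (auto simp: essential_submodule_def)
  define g where "g = (\<lambda>y. \<iota>' (inv_into (carrier M) \<iota> y))"
  have g: "g (\<iota> x) = \<iota>' x" if "x \<in> carrier M" for x
    using that i(2) by (simp add: g_def)
  have "g \<in> rmod_hom R ?A E'"
    unfolding rmod_hom_def
  proof (intro CollectI conjI Pi_I ballI)
    fix x assume "x \<in> carrier ?A"
    then show "g x \<in> carrier E'" using g I'(1) by auto
  next
    fix x y assume "x \<in> carrier ?A" "y \<in> carrier ?A"
    then obtain a b where ab: "a \<in> carrier M" "x = \<iota> a" "b \<in> carrier M" "y = \<iota> b" by auto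
    have "x \<oplus>\<^bsub>E\<^esub> y = \<iota> (a \<oplus>\<^bsub>M\<^esub> b)" using ab I(2) by simp
    then show "g (x \<oplus>\<^bsub>?A\<^esub> y) = g x \<oplus>\<^bsub>E'\<^esub> g y" using ab g I'(2) by simp
  next
    fix x r assume "x \<in> carrier ?A" and r: "r \<in> carrier R"
    then obtain a where ab: "a \<in> carrier M" "x = \<iota> a" by auto
    have "x \<star>\<^bsub>E\<^esub> r = \<iota> (a \<star>\<^bsub>M\<^esub> r)" using ab r I(3) by simp
    then show "g (x \<star>\<^bsub>?A\<^esub> r) = g x \<star>\<^bsub>E'\<^esub> r" using ab r g I'(3) by simp
  qed
  moreover have "(\<lambda>x. x) \<in> rmod_hom R ?A E" using I(1) by (auto simp: rmod_hom_def)
  moreover have "right_module R ?A" by (rule right_module_rsubmodule[OF E sA(1)])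
  moreover have "injective_rmod R E'" "injective_rmod R E" using e e' by blast+
  ultimately obtain h where h: "h \<in> rmod_hom R E E'" "\<forall>x\<in>carrier ?A. h x = g x"
    unfolding injective_rmod_def using E inj_on_id2 by metis
  have h\<iota>: "h (\<iota> x) = \<iota>' x" if "x \<in> carrier M" for x using h(2) g that by simp
  have z: "\<iota> \<zero>\<^bsub>M\<^esub> = \<zero>\<^bsub>E\<^esub>" "\<iota>' \<zero>\<^bsub>M\<^esub> = \<zero>\<^bsub>E'\<^esub>"
    using rmod_hom_zero[OF M E i(1)] rmod_hom_zero[OF M E' i'(1)] .
  have z': "x = \<zero>\<^bsub>M\<^esub>" if "x \<in> carrier M" "\<iota>' x = \<zero>\<^bsub>E'\<^esub>" for x
    using i'(2) that z(2) M.M.zero_closed by (metis inj_onD)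
  let ?K = "{x \<in> carrier E. h x = \<zero>\<^bsub>E'\<^esub>}"
  have "?K = {\<zero>\<^bsub>E\<^esub>}"
  proof (rule essE[OF rsubmodule_kernel[OF E E' h(1)]])
    show "\<iota> ` carrier M \<inter> ?K = {\<zero>\<^bsub>E\<^esub>}"
    proof
      show "\<iota> ` carrier M \<inter> ?K \<subseteq> {\<zero>\<^bsub>E\<^esub>}" using h\<iota> z' z(1) by auto
      show "{\<zero>\<^bsub>E\<^esub>} \<subseteq> \<iota> ` carrier M \<inter> ?K"
        using rmod_hom_zero[OF E E' h(1)] z(1) by (auto intro!: image_eqI[of _ _ "\<zero>\<^bsub>M\<^esub>"])
    qed
  qed
  then have hinj: "inj_on h (carrier E)" using rmod_hom_injI[OF E E' h(1)] by blast
  have "(\<lambda>x. x) \<in> rmod_hom R E E" by (auto simp: rmod_hom_def)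
  then obtain k where k: "k \<in> rmod_hom R E' E" "\<forall>x\<in>carrier E. k (h x) = x"
    using \<open>injective_rmod R E\<close>[unfolded injective_rmod_def, rule_format, of E E' h "\<lambda>x. x"] E E' h(1) hinj
    by blast
  let ?K = "{x \<in> carrier E'. k x = \<zero>\<^bsub>E\<^esub>}"
  have "?K = {\<zero>\<^bsub>E'\<^esub>}"
  proof (rule essE'[OF rsubmodule_kernel[OF E' E k(1)]])
    show "\<iota>' ` carrier M \<inter> ?K = {\<zero>\<^bsub>E'\<^esub>}"
    proof
      show "\<iota>' ` carrier M \<inter> ?K \<subseteq> {\<zero>\<^bsub>E'\<^esub>}"
      proof
        fix y assume y: "y \<in> \<iota>' ` carrier M \<inter> ?K"
        then obtain x where x: "x \<in> carrier M" "y = h (\<iota> x)" using h\<iota> by auto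
        then have "\<iota> x = \<zero>\<^bsub>E\<^esub>" using y k(2) I(1) by auto
        then show "y \<in> {\<zero>\<^bsub>E'\<^esub>}" using x(2) rmod_hom_zero[OF E E' h(1)] by simp
      qed
      show "{\<zero>\<^bsub>E'\<^esub>} \<subseteq> \<iota>' ` carrier M \<inter> ?K"
        using rmod_hom_zero[OF E' E k(1)] z(2) by (auto intro!: image_eqI[of _ _ "\<zero>\<^bsub>M\<^esub>"])
    qed
  qed
  then have kinj: "inj_on k (carrier E')" using rmod_hom_injI[OF E' E k(1)] by blast
  have "h (k y) = y" if y: "y \<in> carrier E'" for y
    using inj_onD[OF kinj] y k(2) rmod_homD(1)[OF k(1)] rmod_homD(1)[OF h(1)] by simp
  then have "carrier E' \<subseteq> h ` carrier E" using rmod_homD(1)[OF k(1)] by (metis image_eqI subsetI)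
  then have "bij_betw h (carrier E) (carrier E')"
    using hinj rmod_homD(1)[OF h(1)] by (auto simp: bij_betw_def)
  then show ?thesis using h(1) h\<iota> by blast
qed

text \<open>
  Automorphisms of two envelopes correspond to each other by conjugation with an isomorphism
  over \<open>M\<close>.
\<close>

lemma automorphism_invariant_any_envelope:
  fixes M :: "('a, 'b, 'm) right_module_scheme" and E :: "('a, ('a, 'b) envelope) right_module"
  assumes M: "right_module R M" and env: "injective_envelope R M E \<iota>"
    and aut: "automorphism_invariant R M" and \<theta>: "\<theta> \<in> rmod_aut R E"
  shows "\<theta> ` (\<iota> ` carrier M) \<subseteq> \<iota> ` carrier M"
proof -
  from aut obtain E' :: "('a, ('a, 'b) envelope) right_module" and \<iota>'
    where env': "injective_envelope R M E' \<iota>'"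
      and inv: "\<forall>\<phi>\<in>rmod_aut R E'. \<phi> ` (\<iota>' ` carrier M) \<subseteq> \<iota>' ` carrier M"
    unfolding automorphism_invariant_def by blast
  obtain \<phi> where \<phi>: "\<phi> \<in> rmod_hom R E E'" "bij_betw \<phi> (carrier E) (carrier E')"
    and \<phi>\<iota>: "\<forall>x\<in>carrier M. \<phi> (\<iota> x) = \<iota>' x"
    using envelope_unique[OF M env env'] by blast
  interpret E: right_module R E using env by (simp add: injective_envelope_def)
  have "\<iota> \<in> rmod_hom R M E" using env by (simp add: injective_envelope_def)
  then have \<iota>: "\<iota> x \<in> carrier E" if "x \<in> carrier M" for x
    using that by (rule rmod_homD(1))
  have \<theta>h: "\<theta> \<in> rmod_hom R E E" "bij_betw \<theta> (carrier E) (carrier E)"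
    using \<theta> by (auto simp: rmod_aut_def)
  define \<psi> where "\<psi> = inv_into (carrier E) \<phi>"
  have \<psi>b: "bij_betw \<psi> (carrier E') (carrier E)" unfolding \<psi>_def by (rule bij_betw_inv_into[OF \<phi>(2)])
  have \<psi>c: "\<psi> y \<in> carrier E" if "y \<in> carrier E'" for y using \<psi>b that by (auto simp: bij_betw_def)
  have \<psi>\<phi>: "\<psi> (\<phi> x) = x" if "x \<in> carrier E" for x
    unfolding \<psi>_def by (rule bij_betw_inv_into_left[OF \<phi>(2) that])
  have \<phi>\<psi>: "\<phi> (\<psi> y) = y" if "y \<in> carrier E'" for y
    unfolding \<psi>_def by (rule bij_betw_inv_into_right[OF \<phi>(2) that])
  have \<psi>: "\<psi> \<in> rmod_hom R E' E"
    unfolding rmod_hom_def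
  proof (intro CollectI conjI Pi_I ballI \<psi>c)
    fix x y assume xy: "x \<in> carrier E'" "y \<in> carrier E'"
    have "\<phi> (\<psi> x \<oplus>\<^bsub>E\<^esub> \<psi> y) = x \<oplus>\<^bsub>E'\<^esub> y" using xy \<psi>c \<phi>\<psi> by (simp add: rmod_homD(2)[OF \<phi>(1)])
    then show "\<psi> (x \<oplus>\<^bsub>E'\<^esub> y) = \<psi> x \<oplus>\<^bsub>E\<^esub> \<psi> y" using \<psi>\<phi>[of "\<psi> x \<oplus>\<^bsub>E\<^esub> \<psi> y"] \<psi>c xy by simp
  next
    fix x a assume xa: "x \<in> carrier E'" "a \<in> carrier R"
    have "\<phi> (\<psi> x \<star>\<^bsub>E\<^esub> a) = x \<star>\<^bsub>E'\<^esub> a" using xa \<psi>c \<phi>\<psi> by (simp add: rmod_homD(3)[OF \<phi>(1)])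
    then show "\<psi> (x \<star>\<^bsub>E'\<^esub> a) = \<psi> x \<star>\<^bsub>E\<^esub> a" using \<psi>\<phi>[of "\<psi> x \<star>\<^bsub>E\<^esub> a"] \<psi>c xa by simp
  qed
  let ?t = "\<lambda>y. \<phi> (\<theta> (\<psi> y))"
  have "bij_betw (\<phi> \<circ> (\<theta> \<circ> \<psi>)) (carrier E') (carrier E')"
    by (intro bij_betw_trans[OF bij_betw_trans[OF \<psi>b \<theta>h(2)] \<phi>(2)])
  then have "bij_betw ?t (carrier E') (carrier E')" by (simp add: comp_def)
  moreover have "?t \<in> rmod_hom R E' E'"
    unfolding rmod_hom_def
  proof (intro CollectI conjI Pi_I ballI)
    note c = \<psi>c rmod_homD(1)[OF \<theta>h(1)]
    fix x assume x: "x \<in> carrier E'"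
    then show "?t x \<in> carrier E'" using c rmod_homD(1)[OF \<phi>(1)] by simp
    show "?t (x \<oplus>\<^bsub>E'\<^esub> y) = ?t x \<oplus>\<^bsub>E'\<^esub> ?t y" if "y \<in> carrier E'" for y
      using x that c by (simp add: rmod_homD(2)[OF \<psi>] rmod_homD(2)[OF \<theta>h(1)] rmod_homD(2)[OF \<phi>(1)])
    show "?t (x \<star>\<^bsub>E'\<^esub> a) = ?t x \<star>\<^bsub>E'\<^esub> a" if "a \<in> carrier R" for a
      using x that c by (simp add: rmod_homD(3)[OF \<psi>] rmod_homD(3)[OF \<theta>h(1)] rmod_homD(3)[OF \<phi>(1)])
  qed
  ultimately have t: "?t \<in> rmod_aut R E'" by (simp add: rmod_aut_def)
  show ?thesis
  proof (rule image_subsetI)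
    fix z assume "z \<in> \<iota> ` carrier M"
    then obtain x where x: "x \<in> carrier M" "z = \<iota> x" by blast
    have "?t (\<iota>' x) \<in> ?t ` (\<iota>' ` carrier M)" using x(1) by blast
    then have "?t (\<iota>' x) \<in> \<iota>' ` carrier M" using bspec[OF inv t] by (rule subsetD[rotated])
    then obtain y where "y \<in> carrier M" "?t (\<iota>' x) = \<iota>' y" by (rule imageE)
    then have y: "y \<in> carrier M" "?t (\<iota>' x) = \<phi> (\<iota> y)" using \<phi>\<iota> by simp_all
    have "\<psi> (\<iota>' x) = \<iota> x" using \<phi>\<iota> \<psi>\<phi> \<iota> x(1) by metis
    then have "\<phi> (\<theta> (\<iota> x)) = \<phi> (\<iota> y)" using y(2) by simp
    then have "\<theta> (\<iota> x) = \<iota> y"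
      using \<psi>\<phi> \<iota> x(1) y(1) rmod_homD(1)[OF \<theta>h(1)] by metis
    then show "\<theta> z \<in> \<iota> ` carrier M" using x(2) y(1) by blast
  qed
qed

section \<open>The injective envelope of the regular module\<close>

lemma regular_simps [simp]:
  "carrier (regular_rmod R) = carrier R" "\<zero>\<^bsub>regular_rmod R\<^esub> = \<zero>\<^bsub>R\<^esub>"
  "add (regular_rmod R) = add R" "ract (regular_rmod R) = monoid.mult R"
  by (simp_all add: regular_rmod_def)

lemma regular_carrier_eq: "(regular_rmod R)\<lparr>carrier := carrier R\<rparr> = regular_rmod R"
  by (simp add: regular_rmod_def)

lemma right_ideal_iff:
  assumes "ring R"
  shows "right_ideal I R \<longleftrightarrow> I \<subseteq> carrier R \<and> \<zero>\<^bsub>R\<^esub> \<in> I \<and> (\<forall>x\<in>I. \<forall>y\<in>I. x \<oplus>\<^bsub>R\<^esub> y \<in> I) \<and>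
    (\<forall>x\<in>I. \<forall>a\<in>carrier R. x \<otimes>\<^bsub>R\<^esub> a \<in> I)"
  unfolding right_ideal_def right_module.rsubmodule_iff[OF right_module_regular[OF assms]] by simp

lemma right_ideal_carrier: "ring R \<Longrightarrow> right_ideal (carrier R) R"
  by (simp add: right_ideal_iff ring.ring_simprules(1,2,5))

lemma right_ideal_subset: "ring R \<Longrightarrow> right_ideal I R \<Longrightarrow> I \<subseteq> carrier R"
  and right_ideal_zero: "ring R \<Longrightarrow> right_ideal I R \<Longrightarrow> \<zero>\<^bsub>R\<^esub> \<in> I"
  by (simp_all add: right_ideal_iff)

locale ring_envelope = injective_module R E
  for R :: "('a, 'r) ring_scheme" and E :: "('a, 'e) right_module" (structure) +
  fixes \<iota> :: "'a \<Rightarrow> 'e"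
  assumes hom: "\<iota> \<in> rmod_hom R (regular_rmod R) E" and inj: "inj_on \<iota> (carrier R)"
    and essential: "essential_submodule R (\<iota> ` carrier R) E"
begin

lemma R_ring: "ring R" by (rule R.ring_axioms)

lemma \<iota>_simps:
  "x \<in> carrier R \<Longrightarrow> \<iota> x \<in> carrier E"
  "x \<in> carrier R \<Longrightarrow> y \<in> carrier R \<Longrightarrow> \<iota> (x \<oplus>\<^bsub>R\<^esub> y) = \<iota> x \<oplus> \<iota> y"
  "x \<in> carrier R \<Longrightarrow> a \<in> carrier R \<Longrightarrow> \<iota> (x \<otimes>\<^bsub>R\<^esub> a) = \<iota> x \<star> a"
  "\<iota> \<zero>\<^bsub>R\<^esub> = \<zero>"
  using rmod_homD[OF hom] rmod_hom_zero[OF right_module_regular[OF R_ring] right_module_axioms hom]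
  by simp_all

lemma \<iota>_eq: "x \<in> carrier R \<Longrightarrow> y \<in> carrier R \<Longrightarrow> \<iota> x = \<iota> y \<longleftrightarrow> x = y"
  using inj by (auto dest: inj_onD)

lemma submod_image_\<iota>:
  assumes "right_ideal I R"
  shows "submod (\<iota> ` I)"
proof (rule submodI)
  have I: "I \<subseteq> carrier R" "\<zero>\<^bsub>R\<^esub> \<in> I" "\<And>x y. x \<in> I \<Longrightarrow> y \<in> I \<Longrightarrow> x \<oplus>\<^bsub>R\<^esub> y \<in> I"
    "\<And>x a. x \<in> I \<Longrightarrow> a \<in> carrier R \<Longrightarrow> x \<otimes>\<^bsub>R\<^esub> a \<in> I"
    using assms by (auto simp: right_ideal_iff[OF R_ring])
  show "\<iota> ` I \<subseteq> carrier E" using I(1) \<iota>_simps(1) by blast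
  show "\<zero> \<in> \<iota> ` I" using I(2) \<iota>_simps(4) by (metis imageI)
  show "x \<oplus> y \<in> \<iota> ` I" if "x \<in> \<iota> ` I" "y \<in> \<iota> ` I" for x y
  proof -
    from that obtain a b where ab: "a \<in> I" "b \<in> I" "x = \<iota> a" "y = \<iota> b" by blast
    then have "x \<oplus> y = \<iota> (a \<oplus>\<^bsub>R\<^esub> b)" using \<iota>_simps(2)[of a b] subsetD[OF I(1)] by simp
    then show ?thesis using I(3) ab by blast
  qed
  show "x \<star> r \<in> \<iota> ` I" if "x \<in> \<iota> ` I" "r \<in> carrier R" for x r
  proof -
    from that obtain a where a: "a \<in> I" "x = \<iota> a" by blast
    then have "x \<star> r = \<iota> (a \<otimes>\<^bsub>R\<^esub> r)" using \<iota>_simps(3)[of a r] subsetD[OF I(1)] that by simp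
    then show ?thesis using I(4) a that by blast
  qed
qed

definition ideal_of :: "'e set \<Rightarrow> 'a set" where
  "ideal_of N = {r \<in> carrier R. \<iota> r \<in> N}"

lemma right_ideal_ideal_of:
  assumes "submod N"
  shows "right_ideal (ideal_of N) R"
  using submodD[OF assms] by (auto simp: right_ideal_iff[OF R_ring] ideal_of_def \<iota>_simps)

lemma image_ideal_of: "N \<subseteq> \<iota> ` carrier R \<Longrightarrow> \<iota> ` ideal_of N = N"
  by (auto simp: ideal_of_def)

text \<open>
  The copy of the ring inside its envelope.
\<close>

abbreviation RR :: "'e set" where "RR \<equiv> \<iota> ` carrier R"

lemma ess_RR: "ess_in RR (carrier E)"
  using essential submod_carrier submod_image_\<iota>[OF right_ideal_carrier[OF R_ring]] submodD(1)
  by (auto simp: essential_submodule_def ess_in_def)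

lemma left_mult_extends:
  assumes a: "a \<in> carrier R"
  shows "\<exists>f. endo f \<and> (\<forall>r\<in>carrier R. f (\<iota> r) = \<iota> (a \<otimes>\<^bsub>R\<^esub> r))"
proof -
  let ?G = "(\<lambda>r. (\<iota> r, \<iota> (a \<otimes>\<^bsub>R\<^esub> r))) ` carrier R"
  have "linear_relation ?G"
    unfolding linear_relation_def
  proof (intro conjI allI impI ballI)
    show "?G \<subseteq> carrier E \<times> carrier E" using a \<iota>_simps(1) by auto
    show "(\<zero>, \<zero>) \<in> ?G"
      by (rule image_eqI[of _ _ "\<zero>\<^bsub>R\<^esub>"]) (simp_all add: a \<iota>_simps(4))
  next
    fix s t s' t' assume "(s, t) \<in> ?G \<and> (s', t') \<in> ?G"
    then obtain r r' where "s = \<iota> r" "t = \<iota> (a \<otimes>\<^bsub>R\<^esub> r)" "r \<in> carrier R"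
      "s' = \<iota> r'" "t' = \<iota> (a \<otimes>\<^bsub>R\<^esub> r')" "r' \<in> carrier R" by blast
    then show "(s \<oplus> s', t \<oplus> t') \<in> ?G"
      using a by (intro image_eqI[of _ _ "r \<oplus>\<^bsub>R\<^esub> r'"]) (simp_all add: \<iota>_simps(2) R.r_distr)
  next
    fix s t b assume b: "b \<in> carrier R" and "(s, t) \<in> ?G"
    then obtain r where "s = \<iota> r" "t = \<iota> (a \<otimes>\<^bsub>R\<^esub> r)" "r \<in> carrier R" by blast
    then show "(s \<star> b, t \<star> b) \<in> ?G"
      using a b by (intro image_eqI[of _ _ "r \<otimes>\<^bsub>R\<^esub> b"]) (simp_all add: \<iota>_simps(3)[symmetric] R.m_assoc)
  qed
  moreover have "y = \<zero>" if "(\<zero>, y) \<in> ?G" for y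
  proof -
    from that obtain r where r: "r \<in> carrier R" "\<zero> = \<iota> r" "y = \<iota> (a \<otimes>\<^bsub>R\<^esub> r)" by blast
    then have "r = \<zero>\<^bsub>R\<^esub>" using \<iota>_eq[of r "\<zero>\<^bsub>R\<^esub>"] \<iota>_simps(4) by simp
    then show ?thesis using r(3) a \<iota>_simps(4) by simp
  qed
  ultimately obtain f where "endo f" "\<forall>x y. (x, y) \<in> ?G \<longrightarrow> f x = y"
    using linear_relation_extends[of ?G] by blast
  then show ?thesis by (intro exI[of _ f]) blast
qed

text \<open>
  Let \<open>N\<close> be an essential right ideal.  The fact \<open>off\<close> says that an off-diagonal map \<open>p f q\<close> sends the
  whole ring into \<open>N\<close>.  Now let \<open>x \<in> N\<close>, let \<open>m\<close> be the image of \<open>1\<close>, and let \<open>f\<close> extend left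
  multiplication by \<open>x\<close>, so that \<open>f m = x\<close>.  Since \<open>p m\<close> lies in the ring, say \<open>p m = m e\<close>, the element
  \<open>f (p m) = x e\<close> lies in the right ideal \<open>N\<close>.  As \<open>p f q\<close> and \<open>q f p\<close> map \<open>m\<close> into \<open>N\<close>, the elements
  \<open>p x = p f m\<close> and \<open>f p m\<close> are congruent modulo \<open>N\<close>.
\<close>

lemma essential_splitting_invariant:
  assumes aut: "\<forall>N. N \<subseteq> RR \<longrightarrow> ess_in N (carrier E) \<longrightarrow> aut_invariant N"
    and RRinv: "splitting_invariant RR"
    and N: "N \<subseteq> RR" "ess_in N (carrier E)"
  shows "splitting_invariant N"
  unfolding splitting_invariant_def
proof (intro allI impI image_subsetI)
  note sN = ess_inD(1)[OF N(2)] and sRR = ess_inD(1)[OF ess_RR]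
  have off: "p (f (q x)) \<in> N" if pq: "splitting p q" and f: "endo f" and x: "x \<in> RR" for p q f x
  proof -
    note S = splittingD[OF pq]
    have xc: "x \<in> carrier E" using x sRR submodD(3) by blast
    have pf: "p (f y) \<in> carrier E" if "y \<in> carrier E" for y using that S(3) endoD(1)[OF f] by blast
    \<comment> \<open>an essential right ideal that contains \<open>q x\<close>, but nothing of \<open>pE\<close> outside \<open>N\<close>\<close>
    let ?N = "{a \<oplus> b | a b. a \<in> N \<inter> rng p \<and> b \<in> q ` RR}"
    have sA: "submod (N \<inter> rng p)" using submod_Int sN submod_rng[OF S(1)] by blast
    have "ess_in (N \<inter> rng p) (rng p)"
      unfolding ess_in_def
    proof (intro conjI allI impI sA submod_rng[OF S(1)])
      fix K assume K: "submod K \<and> K \<subseteq> rng p \<and> N \<inter> rng p \<inter> K = {\<zero>}"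
      then have K0: "x = \<zero>" if "x \<in> N" "x \<in> K" for x using that by blast
      show "K = {\<zero>}" by (rule ess_inD(4)[OF N(2) _ _ K0]) (use K submodD(1)[of K] in blast)+
    qed blast
    then have "ess_in ?N (carrier E)"
      by (rule sum_essential[OF ess_RR pq _ submod_image[OF S(2) sRR]]) blast
    moreover have "?N \<subseteq> RR"
    proof
      fix y assume "y \<in> ?N"
      then obtain a b where ab: "y = a \<oplus> q b" "a \<in> N" "b \<in> RR" by blast
      then have "q b \<in> RR" using splitting_invariantD(2)[OF RRinv pq] by blast
      then show "y \<in> RR" using ab N(1) submodD(4)[OF sRR] by blast
    qed
    ultimately have autN: "aut_invariant ?N" using aut by blast
    have qx: "q x \<in> ?N"
    proof -
      have "\<zero> \<oplus> q x = q x" using S(4)[OF xc] by simp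
      then show ?thesis
        using submodD(2)[OF sA] x by (intro CollectI exI[of _ "\<zero>"] exI[of _ "q x"]) simp
    qed
    have "p (f (q (q x))) \<in> ?N"
      by (rule offdiagonal_preserves[OF autN S(1,2) f S(7) qx])
    then have "p (f (q x)) \<in> ?N" using splitting_idem[OF splitting_sym[OF pq] xc] by simp
    then obtain a b where ab: "p (f (q x)) = a \<oplus> q b" "a \<in> N" "a \<in> rng p" "b \<in> RR" by blast
    have bc: "b \<in> carrier E" using ab(4) sRR submodD(3) by blast
    have "p (a \<oplus> q b) = a"
      using ab(3) splitting_rng(1)[OF pq] S(4,6) bc by (simp add: endoD(2)[OF S(1)])
    then have "p (p (f (q x))) = a" using ab(1) by simp
    then have "p (f (q x)) = a" using splitting_idem[OF pq] endoD(1)[OF f] S(4)[OF xc] by simp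
    then show ?thesis using ab(2) by simp
  qed
  fix p q x assume pq: "splitting p q" and x: "x \<in> N"
  note S = splittingD[OF pq]
  obtain a where a: "a \<in> carrier R" "x = \<iota> a" using x N(1) by blast
  obtain f where f: "endo f" "\<forall>r\<in>carrier R. f (\<iota> r) = \<iota> (a \<otimes>\<^bsub>R\<^esub> r)"
    using left_mult_extends[OF a(1)] by blast
  note fc = endoD(1)[OF f(1)]
  let ?m = "\<iota> \<one>\<^bsub>R\<^esub>"
  have m: "?m \<in> RR" "?m \<in> carrier E" using \<iota>_simps(1) by auto
  have fm: "f ?m = x" using f(2) a by simp
  have "p ?m \<in> RR" using splitting_invariantD(1)[OF RRinv pq m(1)] .
  then obtain e where e: "e \<in> carrier R" "p ?m = \<iota> e" by blast
  have "f (p ?m) = x \<star> e" using f(2) e a \<iota>_simps(3) by simp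
  then have fpm: "f (p ?m) \<in> N" using submodD(5)[OF sN x e(1)] by simp
  have fpc: "p ?m \<in> carrier E" "q ?m \<in> carrier E" using S(3,4) m(2) by auto
  have "q (f (p ?m)) \<in> N" by (rule off[OF splitting_sym[OF pq] f(1) m(1)])
  moreover have "q (f (p ?m)) \<oplus> p (f (p ?m)) \<in> N"
    using fpm S(5)[OF fc[OF fpc(1)]] M.a_comm S(3,4) fc[OF fpc(1)] by simp
  ultimately have "p (f (p ?m)) \<in> N" using submod_cancel[OF sN] S(3) fc[OF fpc(1)] by blast
  moreover have "p (f (q ?m)) \<in> N" by (rule off[OF pq f(1) m(1)])
  moreover have "p (f (p ?m)) \<oplus> p (f (q ?m)) = p (f (p ?m \<oplus> q ?m))"
    using fc fpc by (simp add: endoD(2)[OF f(1)] endoD(2)[OF S(1)])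
  ultimately have "p (f (p ?m \<oplus> q ?m)) \<in> N" using submodD(4)[OF sN] by metis
  then show "p x \<in> N" by (simp only: S(5)[OF m(2)] fm)
qed

lemma CS_submodule_RR:
  assumes "right_CS_ring R"
  shows "CS_submodule RR"
  unfolding CS_submodule_def
proof (intro allI impI, elim conjE)
  interpret reg: right_module R "regular_rmod R" by (rule right_module_regular[OF R_ring])
  fix N assume N: "submod N" "N \<subseteq> RR"
  have "rsubmodule R (ideal_of N) (regular_rmod R)"
    using right_ideal_ideal_of[OF N(1)] by (simp add: right_ideal_def)
  then obtain D where "direct_summand R D (regular_rmod R)"
    and ess: "essential_submodule R (ideal_of N) ((regular_rmod R)\<lparr>carrier := D\<rparr>)"
    using assms unfolding right_CS_ring_def CS_module_def by blast
  then obtain C where D: "right_ideal D R" and C: "right_ideal C R" and DC: "D \<inter> C = {\<zero>\<^bsub>R\<^esub>}"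
    and sum: "D <+>\<^bsub>regular_rmod R\<^esub> C = carrier R"
    unfolding direct_summand_def right_ideal_def by auto
  have sub: "D \<subseteq> carrier R" "C \<subseteq> carrier R" using right_ideal_subset[OF R_ring] D C by simp_all
  note restr = reg.rsubmodule_restrict_iff[OF D[unfolded right_ideal_def]]
  have ND: "ideal_of N \<subseteq> D" using ess restr by (auto simp: essential_submodule_def)
  have "ess_in N (\<iota> ` D)"
    unfolding ess_in_def
  proof (intro conjI allI impI N(1) submod_image_\<iota>[OF D])
    show "N \<subseteq> \<iota> ` D" using image_ideal_of[OF N(2)] ND by blast
    fix K assume K: "submod K \<and> K \<subseteq> \<iota> ` D \<and> N \<inter> K = {\<zero>}"
    have "ideal_of K \<subseteq> D"
    proof
      fix r assume r: "r \<in> ideal_of K"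
      then obtain d where "d \<in> D" "\<iota> r = \<iota> d" using K by (auto simp: ideal_of_def)
      then show "r \<in> D" using r sub(1) \<iota>_eq[of r d] by (auto simp: ideal_of_def)
    qed
    moreover have "ideal_of N \<inter> ideal_of K = {\<zero>\<^bsub>R\<^esub>}"
    proof
      show "ideal_of N \<inter> ideal_of K \<subseteq> {\<zero>\<^bsub>R\<^esub>}"
      proof
        fix r assume r: "r \<in> ideal_of N \<inter> ideal_of K"
        then have "\<iota> r = \<iota> \<zero>\<^bsub>R\<^esub>" using K \<iota>_simps(4) by (auto simp: ideal_of_def)
        then show "r \<in> {\<zero>\<^bsub>R\<^esub>}" using r \<iota>_eq[of r "\<zero>\<^bsub>R\<^esub>"] by (auto simp: ideal_of_def)
      qed
      show "{\<zero>\<^bsub>R\<^esub>} \<subseteq> ideal_of N \<inter> ideal_of K"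
        using submodD(2) N(1) K \<iota>_simps(4) by (auto simp: ideal_of_def)
    qed
    moreover have "rsubmodule R (ideal_of K) (regular_rmod R)"
      using right_ideal_ideal_of K by (simp add: right_ideal_def)
    ultimately have "ideal_of K = {\<zero>\<^bsub>R\<^esub>}"
      using ess restr by (auto simp: essential_submodule_def)
    moreover have "K \<subseteq> RR" using K sub(1) by blast
    ultimately show "K = {\<zero>}" using image_ideal_of[of K] \<iota>_simps(4) by simp
  qed
  moreover have "\<iota> ` D \<inter> \<iota> ` C = {\<zero>}"
    using inj_on_image_Int[OF inj sub] DC \<iota>_simps(4) by simp
  moreover have "\<exists>d\<in>\<iota> ` D. \<exists>c\<in>\<iota> ` C. x = d \<oplus> c" if x: "x \<in> RR" for x
  proof -
    obtain r where r: "r \<in> carrier R" "x = \<iota> r" using x by blast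
    then obtain d c where "d \<in> D" "c \<in> C" "r = d \<oplus>\<^bsub>R\<^esub> c"
      using sum unfolding set_add_def' by force
    moreover have "\<iota> r = \<iota> d \<oplus> \<iota> c" using calculation sub \<iota>_simps(2) by blast
    ultimately show ?thesis using r by blast
  qed
  moreover have "\<iota> ` D \<subseteq> RR" "\<iota> ` C \<subseteq> RR" using sub by auto
  ultimately show "\<exists>D C. submod D \<and> submod C \<and> D \<subseteq> RR \<and> C \<subseteq> RR \<and> D \<inter> C = {\<zero>} \<and>
      (\<forall>x\<in>RR. \<exists>d\<in>D. \<exists>c\<in>C. x = d \<oplus> c) \<and> ess_in N D"
    using submod_image_\<iota>[OF D] submod_image_\<iota>[OF C]
    by (intro exI[of _ "\<iota> ` D"] exI[of _ "\<iota> ` C"] conjI ballI) simp_all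
qed

text \<open>
  If \<open>N\<close> is essential in \<open>pE\<close>, then the invariance of the ring under \<open>p\<close> and \<open>q\<close> lets the
  decomposition \<open>E = pE \<oplus> qE\<close> restrict to the ring.
\<close>

lemma right_CS_ringI:
  assumes inv: "\<And>f x. endo f \<Longrightarrow> x \<in> RR \<Longrightarrow> f x \<in> RR"
  shows "right_CS_ring R"
  unfolding right_CS_ring_def CS_module_def
proof (intro allI impI)
  interpret reg: right_module R "regular_rmod R" by (rule right_module_regular[OF R_ring])
  fix N assume "rsubmodule R N (regular_rmod R)"
  then have N: "right_ideal N R" by (simp add: right_ideal_def)
  have Nc: "N \<subseteq> carrier R" using right_ideal_subset[OF R_ring N] .
  obtain p q where pq: "splitting p q" and ess: "ess_in (\<iota> ` N) (rng p)"
    using exists_splitting[OF submod_image_\<iota>[OF N] submod_zero] by auto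
  note S = splittingD[OF pq] and pr = splitting_rng[OF pq]
    and qr = splitting_rng[OF splitting_sym[OF pq]]
  let ?D = "ideal_of (rng p)" and ?C = "ideal_of (rng q)"
  have D: "right_ideal ?D R" and C: "right_ideal ?C R"
    using right_ideal_ideal_of submod_rng[OF S(1)] submod_rng[OF S(2)] by auto
  have sub: "?D \<subseteq> carrier R" "?C \<subseteq> carrier R" by (auto simp: ideal_of_def)
  have "?D \<inter> ?C = {\<zero>\<^bsub>R\<^esub>}"
  proof
    show "?D \<inter> ?C \<subseteq> {\<zero>\<^bsub>R\<^esub>}"
    proof
      fix r assume r: "r \<in> ?D \<inter> ?C"
      then have "p (\<iota> r) = \<iota> r" "p (\<iota> r) = \<zero>" "r \<in> carrier R"
        using pr(1) qr(2) by (auto simp: ideal_of_def)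
      then show "r \<in> {\<zero>\<^bsub>R\<^esub>}" using \<iota>_eq[of r "\<zero>\<^bsub>R\<^esub>"] \<iota>_simps(4) by simp
    qed
    show "{\<zero>\<^bsub>R\<^esub>} \<subseteq> ?D \<inter> ?C" using right_ideal_zero[OF R_ring] D C by simp
  qed
  moreover have "?D <+>\<^bsub>regular_rmod R\<^esub> ?C = carrier R"
  proof
    show "?D <+>\<^bsub>regular_rmod R\<^esub> ?C \<subseteq> carrier R"
      using sub unfolding set_add_def' by auto
    show "carrier R \<subseteq> ?D <+>\<^bsub>regular_rmod R\<^esub> ?C"
    proof
      fix r assume r: "r \<in> carrier R"
      then have rc: "\<iota> r \<in> carrier E" using \<iota>_simps(1) by blast
      obtain d where d: "d \<in> carrier R" "p (\<iota> r) = \<iota> d" using inv[OF S(1)] r by blast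
      obtain c where c: "c \<in> carrier R" "q (\<iota> r) = \<iota> c" using inv[OF S(2)] r by blast
      have "\<iota> (d \<oplus>\<^bsub>R\<^esub> c) = \<iota> r" using S(5)[OF rc] d c \<iota>_simps(2) by simp
      then have "d \<oplus>\<^bsub>R\<^esub> c = r" using \<iota>_eq d c r by simp
      moreover have "d \<in> ?D" "c \<in> ?C"
        using d c rc imageI[of "\<iota> r" "carrier E" p] imageI[of "\<iota> r" "carrier E" q]
        by (simp_all add: ideal_of_def rng_def)
      ultimately show "r \<in> ?D <+>\<^bsub>regular_rmod R\<^esub> ?C"
        unfolding set_add_def' by auto
    qed
  qed
  ultimately have "direct_summand R ?D (regular_rmod R)"
    unfolding direct_summand_def using D C by (auto simp: right_ideal_def)
  moreover have "essential_submodule R N ((regular_rmod R)\<lparr>carrier := ?D\<rparr>)"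
    unfolding essential_submodule_def reg.rsubmodule_restrict_iff[OF D[unfolded right_ideal_def]]
  proof (intro conjI allI impI)
    show "rsubmodule R N (regular_rmod R)" using N by (simp add: right_ideal_def)
    show "N \<subseteq> ?D" using Nc ess_inD(3)[OF ess] by (auto simp: ideal_of_def)
    fix K assume K: "(rsubmodule R K (regular_rmod R) \<and> K \<subseteq> ?D) \<and>
      N \<inter> K = {\<zero>\<^bsub>(regular_rmod R)\<lparr>carrier := ?D\<rparr>\<^esub>}"
    then have rK: "right_ideal K R" by (simp add: right_ideal_def)
    then have Kc: "K \<subseteq> carrier R" by (rule right_ideal_subset[OF R_ring])
    have "\<iota> ` K = {\<zero>}"
    proof (rule ess_inD(4)[OF ess submod_image_\<iota>[OF rK]])
      show "\<iota> ` K \<subseteq> rng p" using K by (auto simp: ideal_of_def)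
      fix x assume "x \<in> \<iota> ` N" "x \<in> \<iota> ` K"
      then have "x \<in> \<iota> ` (N \<inter> K)" using inj_on_image_Int[OF inj Nc Kc] by blast
      then show "x = \<zero>" using K \<iota>_simps(4) by simp
    qed
    then have "k = \<zero>\<^bsub>R\<^esub>" if "k \<in> K" for k
      using that Kc \<iota>_eq[of k "\<zero>\<^bsub>R\<^esub>"] \<iota>_simps(4) by auto
    moreover have "\<zero>\<^bsub>R\<^esub> \<in> K" using right_ideal_zero[OF R_ring rK] .
    ultimately have "K = {\<zero>\<^bsub>R\<^esub>}" by blast
    then show "K = {\<zero>\<^bsub>(regular_rmod R)\<lparr>carrier := ?D\<rparr>\<^esub>}" by simp
  qed
  ultimately show "\<exists>D. direct_summand R D (regular_rmod R) \<and>
      essential_submodule R N ((regular_rmod R)\<lparr>carrier := D\<rparr>)"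
    by (intro exI[of _ ?D] conjI)
qed

lemma injective_rng:
  assumes pq: "splitting p q"
  shows "injective_rmod R (E\<lparr>carrier := rng p\<rparr>)"
  unfolding injective_rmod_def
proof (intro allI impI, elim conjE)
  note S = splittingD[OF pq]
  let ?P = "E\<lparr>carrier := rng p\<rparr>"
  fix A B :: "('a, 'e) right_module" and g f
  assume A: "right_module R A" "right_module R B" "g \<in> rmod_hom R A B" "inj_on g (carrier A)"
    and f: "f \<in> rmod_hom R A ?P"
  have "f \<in> rmod_hom R A E"
    using f submodD(3)[OF submod_rng[OF S(1)]] by (auto simp: rmod_hom_def)
  then obtain h where h: "h \<in> rmod_hom R B E" "\<forall>x\<in>carrier A. h (g x) = f x"
    using injective A unfolding injective_rmod_def by blast
  have "(\<lambda>x. p (h x)) \<in> rmod_hom R B ?P"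
    unfolding rmod_hom_def
  proof (intro CollectI conjI Pi_I ballI)
    note hc = rmod_homD(1)[OF h(1)]
    fix x assume x: "x \<in> carrier B"
    show "p (h x) \<in> carrier ?P" using hc[OF x] by (simp add: rng_def)
    show "p (h (x \<oplus>\<^bsub>B\<^esub> y)) = p (h x) \<oplus>\<^bsub>?P\<^esub> p (h y)" if "y \<in> carrier B" for y
      using x that hc by (simp add: rmod_homD(2)[OF h(1)] endoD(2)[OF S(1)])
    show "p (h (x \<star>\<^bsub>B\<^esub> a)) = p (h x) \<star>\<^bsub>?P\<^esub> a" if "a \<in> carrier R" for a
      using x that hc by (simp add: rmod_homD(3)[OF h(1)] endoD(3)[OF S(1)])
  qed
  moreover have "p (h (g x)) = f x" if "x \<in> carrier A" for x
  proof -
    have "f x \<in> rng p" using rmod_homD(1)[OF f that] by simp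
    then show ?thesis using h(2) that splitting_rng(1)[OF pq] by simp
  qed
  ultimately show "\<exists>h\<in>rmod_hom R B ?P. \<forall>x\<in>carrier A. h (g x) = f x"
    by (intro bexI[where x = "\<lambda>x. p (h x)"] ballI)
qed

lemma envelope_of_right_ideal:
  assumes I: "right_ideal I R" and pq: "splitting p q" and ess: "ess_in (\<iota> ` I) (rng p)"
  shows "injective_envelope R (right_ideal_rmod R I) (E\<lparr>carrier := rng p\<rparr>) \<iota>"
proof -
  note S = splittingD[OF pq]
  note sp = submod_rng[OF S(1)]
  have Ic: "I \<subseteq> carrier R" using right_ideal_subset[OF R_ring I] .
  have "\<iota> \<in> rmod_hom R (right_ideal_rmod R I) (E\<lparr>carrier := rng p\<rparr>)"
    unfolding rmod_hom_def using ess_inD(3)[OF ess] by (auto simp: \<iota>_simps(2,3) subsetD[OF Ic])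
  moreover have "essential_submodule R (\<iota> ` I) (E\<lparr>carrier := rng p\<rparr>)"
    using ess by (auto simp: essential_submodule_def ess_in_def rsubmodule_restrict_iff[OF sp])
  ultimately show ?thesis
    unfolding injective_envelope_def
    using right_module_rsubmodule[OF right_module_axioms sp] injective_rng[OF pq]
      inj_on_subset[OF inj Ic] by simp
qed

text \<open>
  The right ideal \<open>I + (R \<inter> qE)\<close> is essential, hence invariant under \<open>f p\<close>, and its intersection with
  \<open>pE\<close> is \<open>I\<close>.
\<close>

lemma right_ideal_invariant_in_summand:
  assumes inv: "\<forall>N f. N \<subseteq> RR \<longrightarrow> ess_in N (carrier E) \<longrightarrow> endo f \<longrightarrow> f ` N \<subseteq> N"
    and I: "right_ideal I R" and pq: "splitting p q" and ess: "ess_in (\<iota> ` I) (rng p)"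
    and f: "f \<in> rmod_hom R (E\<lparr>carrier := rng p\<rparr>) (E\<lparr>carrier := rng p\<rparr>)" and x: "x \<in> \<iota> ` I"
  shows "f x \<in> \<iota> ` I"
proof -
  note S = splittingD[OF pq]
  note sp = submod_rng[OF S(1)] and sI = submod_image_\<iota>[OF I]
  have Ic: "I \<subseteq> carrier R" using right_ideal_subset[OF R_ring I] .
  have fr: "f y \<in> rng p" if "y \<in> rng p" for y using rmod_homD(1)[OF f] that by simp
  have pr: "p y \<in> rng p" if "y \<in> carrier E" for y using that by (auto simp: rng_def)
  let ?f = "\<lambda>y. f (p y)"
  have f': "endo ?f"
  proof (rule endoI)
    show "?f y \<in> carrier E" if "y \<in> carrier E" for y using fr pr that submodD(3)[OF sp] by blast
    show "?f (y \<oplus> z) = ?f y \<oplus> ?f z" if "y \<in> carrier E" "z \<in> carrier E" for y z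
      using rmod_homD(2)[OF f] pr that by (simp add: endoD(2)[OF S(1)])
    show "?f (y \<star> a) = ?f y \<star> a" if "y \<in> carrier E" "a \<in> carrier R" for y a
      using rmod_homD(3)[OF f] pr that by (simp add: endoD(3)[OF S(1)])
  qed
  let ?B = "RR \<inter> rng q"
  let ?N = "{a \<oplus> b | a b. a \<in> \<iota> ` I \<and> b \<in> ?B}"
  have sB: "submod ?B" using submod_Int ess_inD(1)[OF ess_RR] submod_rng[OF S(2)] by blast
  have "q ` RR \<subseteq> RR" by (rule inv[rule_format, OF subset_refl ess_RR S(2)])
  then have qB: "q ` RR \<subseteq> ?B" using ess_inD(3)[OF ess_RR] by (auto simp: rng_def)
  have essN: "ess_in ?N (carrier E)" by (rule sum_essential[OF ess_RR pq ess sB qB])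
  have NR: "?N \<subseteq> RR" using submodD(4)[OF ess_inD(1)[OF ess_RR]] Ic by blast
  have xp: "x \<in> rng p" "p x = x" "x \<in> carrier E"
    using x ess_inD(3)[OF ess] splitting_rng(1)[OF pq] by blast+
  have "x \<in> ?N"
  proof -
    have "x \<oplus> \<zero> = x" using xp(3) by simp
    then show ?thesis
      using x submodD(2)[OF sB] by (intro CollectI exI[of _ x] exI[of _ "\<zero>"]) simp
  qed
  then have "?f x \<in> ?f ` ?N" by (rule imageI)
  then have "?f x \<in> ?N" by (rule subsetD[OF inv[rule_format, OF NR essN f']])
  then obtain a b where ab: "f x = a \<oplus> b" "a \<in> \<iota> ` I" "b \<in> rng q" using xp(2) by auto
  have "a \<in> carrier E" "p a = a" using ab(2) ess_inD(3)[OF ess] splitting_rng(1)[OF pq] by blast+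
  moreover have "b \<in> carrier E" "p b = \<zero>" using ab(3) splitting_rng(2)[OF splitting_sym[OF pq]] by blast+
  ultimately have "p (a \<oplus> b) = a" by (simp add: endoD(2)[OF S(1)])
  moreover have "p (f x) = f x" using fr[OF xp(1)] splitting_rng(1)[OF pq] by blast
  ultimately have "f x = a" using ab(1) by simp
  then show ?thesis using ab(2) by simp
qed

end

section \<open>The equivalence\<close>

lemma ring_envelopeI:
  assumes "injective_envelope R (regular_rmod R) E \<iota>"
  shows "ring_envelope R E \<iota>"
  using assms by (auto simp: injective_envelope_def ring_envelope_def ring_envelope_axioms_def
      injective_module_def injective_module_axioms_def)

lemma quasi_injective_imp_automorphism_invariant:
  fixes M :: "('a, 'b, 'm) right_module_scheme"
  assumes "quasi_injective R M"
  shows "automorphism_invariant R M"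
proof -
  obtain E :: "('a, ('a, 'b) envelope) right_module" and \<iota>
    where "injective_envelope R M E \<iota>"
      and inv: "\<forall>f\<in>rmod_hom R E E. f ` (\<iota> ` carrier M) \<subseteq> \<iota> ` carrier M"
    using assms unfolding quasi_injective_def by blast
  moreover have "\<forall>\<phi>\<in>rmod_aut R E. \<phi> ` (\<iota> ` carrier M) \<subseteq> \<iota> ` carrier M"
    using inv by (simp add: rmod_aut_def)
  ultimately show ?thesis unfolding automorphism_invariant_def by blast
qed

lemma q_ring_imp_a_ring: "right_q_ring R \<Longrightarrow> right_a_ring R"
  unfolding right_q_ring_def right_a_ring_def
  using quasi_injective_imp_automorphism_invariant by blast

lemma q_ring_imp_CS_ring:
  assumes R: "ring R" and q: "right_q_ring R"
  shows "right_CS_ring R"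
proof -
  have "quasi_injective R (right_ideal_rmod R (carrier R))"
    using q right_ideal_carrier[OF R] by (simp add: right_q_ring_def)
  then obtain E \<iota> where env: "injective_envelope R (regular_rmod R) (E :: ('a, ('a, 'a) envelope) right_module) \<iota>"
    and inv: "\<forall>f\<in>rmod_hom R E E. f ` (\<iota> ` carrier R) \<subseteq> \<iota> ` carrier R"
    unfolding quasi_injective_def regular_carrier_eq by auto
  interpret ring_envelope R E \<iota> using env by (rule ring_envelopeI)
  show ?thesis by (rule right_CS_ringI) (use inv in blast)
qed

lemma CS_a_ring_imp_q_ring:
  fixes R :: "('a, 'r) ring_scheme"
  assumes R: "ring R" and CS: "right_CS_ring R" and a: "right_a_ring R"
  shows "right_q_ring R"
proof -
  have "automorphism_invariant R (right_ideal_rmod R (carrier R))"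
    using a right_ideal_carrier[OF R] by (simp add: right_a_ring_def)
  then obtain E \<iota> where env: "injective_envelope R (regular_rmod R) (E :: ('a, ('a, 'a) envelope) right_module) \<iota>"
    unfolding automorphism_invariant_def regular_carrier_eq by auto
  interpret ring_envelope R E \<iota> using env by (rule ring_envelopeI)
  have id: "splitting (\<lambda>x. x) (\<lambda>x. \<zero>\<^bsub>E\<^esub>)"
    by (simp add: splitting_def endo_id endo_const_zero)
  have r: "rng (\<lambda>x. x) = carrier E" by (simp add: rng_def)
  have aut: "aut_invariant N" if N: "N \<subseteq> RR" "ess_in N (carrier E)" for N
  proof -
    note sN = ess_inD(1)[OF N(2)]
    have I: "right_ideal (ideal_of N) R" by (rule right_ideal_ideal_of[OF sN])
    have "injective_envelope R (right_ideal_rmod R (ideal_of N)) (E\<lparr>carrier := rng (\<lambda>x. x)\<rparr>) \<iota>"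
      by (rule envelope_of_right_ideal[OF I id]) (simp add: r image_ideal_of[OF N(1)] N(2))
    then have e: "injective_envelope R (right_ideal_rmod R (ideal_of N)) E \<iota>" by (simp add: r)
    have m: "right_module R (right_ideal_rmod R (ideal_of N))"
      using right_module_rsubmodule[OF right_module_regular[OF R]] I by (simp add: right_ideal_def)
    have "automorphism_invariant R (right_ideal_rmod R (ideal_of N))"
      using a I by (simp add: right_a_ring_def)
    from automorphism_invariant_any_envelope[OF m e this]
    show ?thesis using sN by (simp add: aut_invariant_def image_ideal_of[OF N(1)])
  qed
  have RRs: "splitting_invariant RR"
    by (rule CS_splitting_invariant[OF aut[OF subset_refl ess_RR] CS_submodule_RR[OF CS]])
  have aut': "\<forall>N. N \<subseteq> RR \<longrightarrow> ess_in N (carrier E) \<longrightarrow> aut_invariant N"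
    using aut by simp
  have inv: "\<forall>N f. N \<subseteq> RR \<longrightarrow> ess_in N (carrier E) \<longrightarrow> endo f \<longrightarrow> f ` N \<subseteq> N"
  proof (intro allI impI)
    fix N f assume N: "N \<subseteq> RR" "ess_in N (carrier E)" and f: "endo f"
    have N': "splitting_invariant N"
      by (rule essential_splitting_invariant[OF aut' RRs N])
    show "f ` N \<subseteq> N" by (rule image_subsetI) (rule endo_invariant[OF aut[OF N] N' f])
  qed
  show ?thesis
    unfolding right_q_ring_def
  proof (intro allI impI)
    fix I assume I: "right_ideal I R"
    obtain p q where pq: "splitting p q" and ess: "ess_in (\<iota> ` I) (rng p)"
      using exists_splitting[OF submod_image_\<iota>[OF I] submod_zero] by auto
    have "\<forall>f\<in>rmod_hom R (E\<lparr>carrier := rng p\<rparr>) (E\<lparr>carrier := rng p\<rparr>). f ` (\<iota> ` I) \<subseteq> \<iota> ` I"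
    proof
      fix f assume f: "f \<in> rmod_hom R (E\<lparr>carrier := rng p\<rparr>) (E\<lparr>carrier := rng p\<rparr>)"
      show "f ` (\<iota> ` I) \<subseteq> \<iota> ` I"
        by (rule image_subsetI) (rule right_ideal_invariant_in_summand[OF inv I pq ess f])
    qed
    then show "quasi_injective R (right_ideal_rmod R I)"
      unfolding quasi_injective_def
      using envelope_of_right_ideal[OF I pq ess]
      by (intro exI[of _ "E\<lparr>carrier := rng p\<rparr>"] exI[of _ \<iota>]) simp
  qed
qed

theorem theorem4p9:
  fixes R :: "('a, 'r) ring_scheme" (structure)
  assumes "ring R"
    and "indecomposable_ring R"
    and "\<not> local_ring R"
  shows "right_q_ring R \<longleftrightarrow> right_CS_ring R \<and> right_a_ring R"
  using q_ring_imp_CS_ring[OF assms(1)] q_ring_imp_a_ring CS_a_ring_imp_q_ring[OF assms(1)]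
  by blast

end
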